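(* With standard resolution in place of SLD-resolution, the fragment $\mathcal{H}^{2c}_{2,\infty}$ is reducible$_R$ to $\mathcal{H}^{2c}_{2,2}$. That is, for every $C\in\mathcal{H}^{2c}_{2,\infty}$ with $|C|>2$, there exists $b'<|C|$ such that $C$ is the conclusion of a standard-resolution inference whose premises lie in $\mathcal{H}^{2c}_{2,b'}$.
   Context: Clauses and fragments. - Clauses are function-free second-order Horn clauses: a head (at most one positive literal) and a finite body of negative literals. Each literal is a predicate variable of arity in $\mathbb{N}^*$ applied to term variables. - The body size $|C|$ is the number of body literals. - A clause is connected if its literals cannot be partitioned into two non-empty sets with disjoint variable sets. - $\mathcal{H}^{2c}$ is the set of connected clauses in which every term variable occurs in at least two distinct literals. - $\mathcal{H}^{2c}_{a,b}$ denotes those clauses with all literal arities at most $a$ and body size at most $b$; $\infty$ means no bound. - Fragments are considered modulo variable renaming and contain only the most general clauses up to variable unification. Standard resolution. - Substitutions map term variables to term variables and predicate variables to predicate variables of the same arity. - Standard resolution is resolution extended to these second-order clauses using most general unifiers under such substitutions. - Unlike SLD-resolution, it allows factoring: unifying two literals of the same clause and thereby merging duplicate literals. - In particular, an inference may resolve a body literal of one premise against the head of another and then factor the resolvent. Reducibility$_R$. A fragment $\mathcal{F}$ is reducible$_R$ to $\mathcal{F}_{\infty,b}$ if, for every $C\in\mathcal{F}$ with $b<|C|$, there exists $b'<|C|$ such that $C$ is the conclusion of a standard-resolution inference with premises in $\mathcal{F}_{\infty,b'}$. *)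

theory Defs
  imports Main "HOL-Library.Multiset" "HOL-Library.Extended_Nat"
begin

type_synonym tvar = nat

text \<open>A predicate variable carries its arity, so equally named variables of different
  arities are different variables, and there are infinitely many of each arity.\<close>

datatype pvar = PVar (pname: nat) (arity: nat)

datatype atom = Atom (pred: pvar) (args: "tvar list")

datatype literal = Pos (atom_of: atom) | Neg (atom_of: atom)

text \<open>The body is a multiset: applying a substitution never merges literals by itself,
  merging is done by factoring only.\<close>

datatype clause = Clause (head: "atom option") (body: "atom multiset")

definition body_size :: "clause \<Rightarrow> nat" where
  "body_size C = size (body C)"

definition literals :: "clause \<Rightarrow> literal multiset" where
  "literals C = (case head C of None \<Rightarrow> {#} | Some A \<Rightarrow> {#Pos A#}) + image_mset Neg (body C)"

definition lit_tvars :: "literal \<Rightarrow> tvar set" where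
  "lit_tvars l = set (args (atom_of l))"

definition lits_tvars :: "literal multiset \<Rightarrow> tvar set" where
  "lits_tvars M = (\<Union>l\<in>set_mset M. lit_tvars l)"

definition tvars :: "clause \<Rightarrow> tvar set" where
  "tvars C = lits_tvars (literals C)"

definition pvars :: "clause \<Rightarrow> pvar set" where
  "pvars C = (\<lambda>l. pred (atom_of l)) ` set_mset (literals C)"

definition wf_atom :: "atom \<Rightarrow> bool" where
  "wf_atom A \<longleftrightarrow> 1 \<le> arity (pred A) \<and> length (args A) = arity (pred A)"

definition wf_clause :: "clause \<Rightarrow> bool" where
  "wf_clause C \<longleftrightarrow> (\<forall>l\<in>#literals C. wf_atom (atom_of l))"

text \<open>Connectedness is about shared term variables; a shared predicate variable does not
  connect two literals.\<close>

definition connected :: "clause \<Rightarrow> bool" where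
  "connected C \<longleftrightarrow>
    \<not> (\<exists>M N. literals C = M + N \<and> M \<noteq> {#} \<and> N \<noteq> {#} \<and> lits_tvars M \<inter> lits_tvars N = {})"

definition two_occurring :: "clause \<Rightarrow> bool" where
  "two_occurring C \<longleftrightarrow>
    (\<forall>x\<in>tvars C. \<exists>l\<in>#literals C. \<exists>k\<in>#literals C. l \<noteq> k \<and> x \<in> lit_tvars l \<and> x \<in> lit_tvars k)"

datatype subst = Subst (on_pvar: "pvar \<Rightarrow> pvar") (on_tvar: "tvar \<Rightarrow> tvar")

definition is_subst :: "subst \<Rightarrow> bool" where
  "is_subst \<sigma> \<longleftrightarrow> (\<forall>P. arity (on_pvar \<sigma> P) = arity P)"

definition subst_atom :: "subst \<Rightarrow> atom \<Rightarrow> atom" where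
  "subst_atom \<sigma> A = Atom (on_pvar \<sigma> (pred A)) (map (on_tvar \<sigma>) (args A))"

definition subst_clause :: "subst \<Rightarrow> clause \<Rightarrow> clause" where
  "subst_clause \<sigma> C =
    Clause (map_option (subst_atom \<sigma>) (head C)) (image_mset (subst_atom \<sigma>) (body C))"

definition comp_subst :: "subst \<Rightarrow> subst \<Rightarrow> subst" where
  "comp_subst \<rho> \<sigma> = Subst (on_pvar \<rho> \<circ> on_pvar \<sigma>) (on_tvar \<rho> \<circ> on_tvar \<sigma>)"

definition is_renaming :: "subst \<Rightarrow> bool" where
  "is_renaming \<sigma> \<longleftrightarrow> is_subst \<sigma> \<and> bij (on_pvar \<sigma>) \<and> bij (on_tvar \<sigma>)"

definition variant :: "clause \<Rightarrow> clause \<Rightarrow> bool" where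
  "variant C D \<longleftrightarrow> (\<exists>\<sigma>. is_renaming \<sigma> \<and> subst_clause \<sigma> C = D)"

definition unifier :: "subst \<Rightarrow> atom \<Rightarrow> atom \<Rightarrow> bool" where
  "unifier \<sigma> A B \<longleftrightarrow> is_subst \<sigma> \<and> subst_atom \<sigma> A = subst_atom \<sigma> B"

definition is_mgu :: "subst \<Rightarrow> atom \<Rightarrow> atom \<Rightarrow> bool" where
  "is_mgu \<sigma> A B \<longleftrightarrow>
    unifier \<sigma> A B \<and> (\<forall>\<tau>. unifier \<tau> A B \<longrightarrow> (\<exists>\<rho>. is_subst \<rho> \<and> \<tau> = comp_subst \<rho> \<sigma>))"

text \<open>The clauses of a set that are not obtained from another one (up to renaming) of the set
  by unifying term variables or predicate variables.\<close>

definition most_general :: "clause set \<Rightarrow> clause set" where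
  "most_general F = {C \<in> F. \<forall>D\<in>F. \<forall>\<sigma>. is_subst \<sigma> \<and> subst_clause \<sigma> D = C \<longrightarrow> variant C D}"

definition H2c :: "clause set" where
  "H2c = most_general {C. wf_clause C \<and> connected C \<and> two_occurring C}"

text \<open>The subfragment written with subscripts a, b. Unifying variables changes neither arities
  nor the body size, so imposing the bounds commutes with taking most general clauses.\<close>

definition bounded :: "clause set \<Rightarrow> enat \<Rightarrow> enat \<Rightarrow> clause set" where
  "bounded F a b =
    {C \<in> F. (\<forall>l\<in>#literals C. enat (arity (pred (atom_of l))) \<le> a) \<and> enat (body_size C) \<le> b}"

definition binary_resolvent :: "clause \<Rightarrow> clause \<Rightarrow> clause \<Rightarrow> bool" where
  "binary_resolvent C D R \<longleftrightarrow>
    (\<exists>D' A B \<sigma>. variant D D' \<and> tvars C \<inter> tvars D' = {} \<and> pvars C \<inter> pvars D' = {} \<and>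
       A \<in># body C \<and> head D' = Some B \<and> is_mgu \<sigma> A B \<and>
       R = subst_clause \<sigma> (Clause (head C) ((body C - {#A#}) + body D')))"

text \<open>Literals of opposite sign are never factored, so in a Horn clause only body literals
  are.\<close>

definition factor :: "clause \<Rightarrow> clause \<Rightarrow> bool" where
  "factor C D \<longleftrightarrow>
    (\<exists>A B \<sigma>. {#A, B#} \<subseteq># body C \<and> is_mgu \<sigma> A B \<and>
       D = subst_clause \<sigma> (Clause (head C) (body C - {#B#})))"

text \<open>Clauses are taken modulo renaming, hence so is the conclusion.\<close>

definition std_resolution :: "clause \<Rightarrow> clause \<Rightarrow> clause \<Rightarrow> bool" where
  "std_resolution C D E \<longleftrightarrow>
    (\<exists>C' D' R R'. factor\<^sup>*\<^sup>* C C' \<and> factor\<^sup>*\<^sup>* D D' \<and> binary_resolvent C' D' R \<and>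
       factor\<^sup>*\<^sup>* R R' \<and> variant R' E)"

definition reducible_R :: "clause set \<Rightarrow> nat \<Rightarrow> bool" where
  "reducible_R F b \<longleftrightarrow>
    (\<forall>C\<in>F. b < body_size C \<longrightarrow>
      (\<exists>b'<body_size C. \<exists>C1\<in>bounded F \<infinity> (enat b'). \<exists>C2\<in>bounded F \<infinity> (enat b').
         std_resolution C1 C2 C))"

lemma bounded_bounded: "bounded (bounded F a \<infinity>) \<infinity> b = bounded F a b"
  by (auto simp: bounded_def)

lemma reducible_R_bounded_iff:
  "reducible_R (bounded F a \<infinity>) b \<longleftrightarrow>
    (\<forall>C\<in>bounded F a \<infinity>. b < body_size C \<longrightarrow>
      (\<exists>b'<body_size C. \<exists>C1\<in>bounded F a (enat b'). \<exists>C2\<in>bounded F a (enat b').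
         std_resolution C1 C2 C))"
  by (simp add: reducible_R_def bounded_bounded)

end

theory Submission imports Defs begin

text \<open>Read a clause of \<open>H2c\<close> with arities at most 2 as a graph: term variables are vertices and
  literals are edges, so that the clause is connected with all degrees at least 2. A resolution
  step whose conclusion is \<open>C\<close> covers \<open>C\<close> by two subgraphs, each closed up by an extra edge
  \<open>H\<close>; factoring allows the two subgraphs to overlap.

  If two body literals with a common variable share at most two variables with the rest of \<open>C\<close>,
  or if some set of at least two body literals shares only one variable with a rest that still
  contains a body literal, this set can be split off behind \<open>H\<close> without overlap. Otherwise the
  body is a simple graph in which every variable outside the head has degree at least 3. It then
  contains a path \<open>A(a,b), M(b,c), F(c,d)\<close> with \<open>b\<close> and \<open>c\<close> outside the head, and \<open>C\<close> follows from
  \<open>H(a,d) \<leftarrow> A(a,b), M(b,c), F(c,d)\<close> and from \<open>C\<close> with \<open>A\<close>, \<open>F\<close> replaced by \<open>H(a,d)\<close>, by factoring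
  the two copies of \<open>M\<close>. The path can be chosen such that the second premise stays connected.\<close>

section \<open>Clauses as sets of atoms\<close>

definition av :: "atom \<Rightarrow> tvar set" where
  "av A = set (args A)"

text \<open>Signs are forgotten but multiplicities are kept, so an atom that is both the head and a
  body atom counts twice.\<close>

definition atoms :: "clause \<Rightarrow> atom multiset" where
  "atoms C = (case head C of None \<Rightarrow> {#} | Some A \<Rightarrow> {#A#}) + body C"

text \<open>A formulation by cuts: a set \<open>S\<close> of variables that no atom straddles
  contains all variables of the atoms or none. Such sets pull back along substitutions and can be
  enlarged, which is more convenient than handling partitions of literals.\<close>

definition conn :: "atom set \<Rightarrow> bool" where
  "conn K \<longleftrightarrow> (\<forall>S. (\<forall>A\<in>K. av A \<subseteq> S \<or> av A \<inter> S = {}) \<longrightarrow>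
     (\<forall>A\<in>K. av A \<subseteq> S) \<or> (\<forall>A\<in>K. av A \<inter> S = {}))"

text \<open>The two occurrences lie in different atoms, not merely in different literals; on the
  atoms of a clause with \<open>distinct_atoms\<close> this agrees with
  \<open>two_occurring\<close>.\<close>

definition two_occ :: "atom set \<Rightarrow> bool" where
  "two_occ K \<longleftrightarrow> (\<forall>A\<in>K. \<forall>x\<in>av A. \<exists>B\<in>K. B \<noteq> A \<and> x \<in> av B)"

definition pre_fragment :: "clause set" where
  "pre_fragment = {C. wf_clause C \<and> connected C \<and> two_occurring C}"

definition distinct_atoms :: "clause \<Rightarrow> bool" where
  "distinct_atoms C \<longleftrightarrow> (\<forall>A. count (atoms C) A \<le> 1)"

lemma H2c_eq: "H2c = most_general pre_fragment"
  by (simp add: H2c_def pre_fragment_def)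

lemma atom_of_literals: "image_mset atom_of (literals C) = atoms C"
  by (auto simp: literals_def atoms_def image_mset.compositionality comp_def split: option.split)

lemma set_atoms: "set_mset (atoms C) = set_option (head C) \<union> set_mset (body C)"
  by (auto simp: atoms_def split: option.split)

lemma set_atoms_literals: "set_mset (atoms C) = atom_of ` set_mset (literals C)"
  by (metis atom_of_literals set_image_mset)

lemma wf_clause_iff: "wf_clause C \<longleftrightarrow> (\<forall>A\<in>#atoms C. wf_atom A)"
  by (simp add: wf_clause_def set_atoms_literals)

lemma tvars_eq: "tvars C = (\<Union>A\<in>set_mset (atoms C). av A)"
  by (simp add: tvars_def lits_tvars_def lit_tvars_def set_atoms_literals av_def)

lemma pvars_eq: "pvars C = pred ` set_mset (atoms C)"
  by (auto simp: pvars_def set_atoms_literals)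

lemma wf_atom_av: "wf_atom A \<Longrightarrow> av A \<noteq> {}"
  by (auto simp: wf_atom_def av_def)

lemma finite_av [simp]: "finite (av A)"
  by (simp add: av_def)

text \<open>The variables of one part of a disconnection serve as \<open>S\<close>. Atoms of a
  well-formed clause have variables, so one atom from each part refutes the two
  alternatives.\<close>

lemma conn_connected:
  assumes "conn (set_mset (atoms C))" and wf: "wf_clause C"
  shows "connected C"
  unfolding connected_def
proof (rule notI, elim exE conjE)
  fix M N assume *: "literals C = M + N" "M \<noteq> {#}" "N \<noteq> {#}" "lits_tvars M \<inter> lits_tvars N = {}"
  have M: "av (atom_of l) \<subseteq> lits_tvars M" if "l \<in># M" for l
    using that by (auto simp: lits_tvars_def lit_tvars_def av_def)
  have N: "av (atom_of l) \<inter> lits_tvars M = {}" if "l \<in># N" for l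
    using that *(4) by (fastforce simp: lits_tvars_def lit_tvars_def av_def)
  have "\<forall>A\<in>#atoms C. av A \<subseteq> lits_tvars M \<or> av A \<inter> lits_tvars M = {}"
    using M N by (auto simp: set_atoms_literals *(1))
  then have "(\<forall>A\<in>#atoms C. av A \<subseteq> lits_tvars M) \<or> (\<forall>A\<in>#atoms C. av A \<inter> lits_tvars M = {})"
    using assms(1) unfolding conn_def by blast
  moreover obtain l k where l: "l \<in># M" and k: "k \<in># N"
    using *(2,3) by blast
  moreover have "atom_of l \<in># atoms C" "atom_of k \<in># atoms C"
    using l k by (auto simp: set_atoms_literals *(1))
  moreover from this have "av (atom_of l) \<noteq> {}" "av (atom_of k) \<noteq> {}"
    using wf by (auto simp: wf_clause_iff wf_atom_av)
  ultimately show False using M[OF l] N[OF k] by blast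
qed

text \<open>The literals inside \<open>S\<close> and the remaining ones form a partition that
  connectedness excludes unless one part is empty.\<close>

lemma connected_conn:
  assumes "connected C"
  shows "conn (set_mset (atoms C))"
  unfolding conn_def
proof (intro allI impI)
  fix S assume *: "\<forall>A\<in>#atoms C. av A \<subseteq> S \<or> av A \<inter> S = {}"
  let ?P = "\<lambda>l. av (atom_of l) \<subseteq> S"
  let ?M = "filter_mset ?P (literals C)" and ?N = "filter_mset (\<lambda>l. \<not> ?P l) (literals C)"
  have "lits_tvars ?M \<subseteq> S" by (auto simp: lits_tvars_def lit_tvars_def av_def)
  moreover have "lits_tvars ?N \<inter> S = {}"
    using * by (fastforce simp: lits_tvars_def lit_tvars_def av_def set_atoms_literals)
  ultimately have "lits_tvars ?M \<inter> lits_tvars ?N = {}" by blast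
  moreover have "literals C = ?M + ?N" by (rule multiset_partition)
  ultimately have "?M = {#} \<or> ?N = {#}" using assms unfolding connected_def by blast
  then have "(\<forall>l\<in>#literals C. \<not> ?P l) \<or> (\<forall>l\<in>#literals C. ?P l)"
    by auto
  then show "(\<forall>A\<in>#atoms C. av A \<subseteq> S) \<or> (\<forall>A\<in>#atoms C. av A \<inter> S = {})"
    using * by (fastforce simp: set_atoms_literals)
qed

lemma pre_fragmentI:
  assumes "wf_clause C" "conn (set_mset (atoms C))" "two_occ (set_mset (atoms C))"
  shows "C \<in> pre_fragment"
proof -
  have "two_occurring C" unfolding two_occurring_def
  proof
    fix x assume "x \<in> tvars C"
    then obtain A where A: "A \<in># atoms C" "x \<in> av A" by (auto simp: tvars_eq)
    then obtain B where B: "B \<in># atoms C" "B \<noteq> A" "x \<in> av B"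
      using assms(3) unfolding two_occ_def by blast
    obtain l k where "l \<in># literals C" "A = atom_of l" "k \<in># literals C" "B = atom_of k"
      using A(1) B(1) by (auto simp: set_atoms_literals)
    with A(2) B(2,3) show "\<exists>l\<in>#literals C. \<exists>k\<in>#literals C. l \<noteq> k \<and> x \<in> lit_tvars l \<and> x \<in> lit_tvars k"
      unfolding lit_tvars_def av_def by metis
  qed
  then show ?thesis using assms by (simp add: pre_fragment_def conn_connected)
qed

lemma pre_fragment_two_occ:
  assumes "C \<in> pre_fragment" "distinct_atoms C"
  shows "two_occ (set_mset (atoms C))"
  unfolding two_occ_def
proof (intro ballI)
  fix A x assume A: "A \<in># atoms C" "x \<in> av A"
  then have "x \<in> tvars C" by (auto simp: tvars_eq)
  then obtain l k where lk: "l \<in># literals C" "k \<in># literals C" "l \<noteq> k" "x \<in> lit_tvars l" "x \<in> lit_tvars k"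
    using assms(1) by (auto simp: pre_fragment_def two_occurring_def)
  have "atom_of l \<noteq> atom_of k"
  proof
    assume eq: "atom_of l = atom_of k"
    \<comment> \<open>Different literals with the same atom would make this atom count
      twice.\<close>
    have "{#l, k#} \<subseteq># literals C"
      using lk(1-3) by (metis insert_DiffM insert_noteq_member insert_subset_eq_iff single_subset_iff)
    then have "{#atom_of l, atom_of k#} \<subseteq># atoms C"
      using image_mset_subseteq_mono[of "{#l, k#}" "literals C" atom_of] by (simp add: atom_of_literals)
    then have "count (atoms C) (atom_of l) \<ge> 2"
      using eq by (auto dest: mset_subset_eq_count[of _ _ "atom_of l"])
    then show False using assms(2) unfolding distinct_atoms_def by (metis One_nat_def Suc_n_not_le_n le_trans numeral_2_eq_2)
  qed
  then show "\<exists>B\<in>#atoms C. B \<noteq> A \<and> x \<in> av B"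
    using lk by (metis (no_types, lifting) av_def imageI lit_tvars_def set_atoms_literals)
qed

section \<open>Action of substitutions on atoms and clauses\<close>

lemma subst_atom_sel [simp]:
  "pred (subst_atom \<sigma> A) = on_pvar \<sigma> (pred A)" "args (subst_atom \<sigma> A) = map (on_tvar \<sigma>) (args A)"
  by (simp_all add: subst_atom_def)

lemma av_subst [simp]: "av (subst_atom \<sigma> A) = on_tvar \<sigma> ` av A"
  by (simp add: av_def)

lemma subst_atom_comp: "subst_atom (comp_subst \<rho> \<sigma>) A = subst_atom \<rho> (subst_atom \<sigma> A)"
  by (simp add: subst_atom_def comp_subst_def)

lemma subst_clause_comp: "subst_clause (comp_subst \<rho> \<sigma>) C = subst_clause \<rho> (subst_clause \<sigma> C)"
proof -
  have "subst_atom (comp_subst \<rho> \<sigma>) = subst_atom \<rho> \<circ> subst_atom \<sigma>"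
    by (simp add: fun_eq_iff subst_atom_comp)
  then show ?thesis by (simp add: subst_clause_def option.map_comp image_mset.compositionality)
qed

lemma is_subst_comp: "is_subst \<rho> \<Longrightarrow> is_subst \<sigma> \<Longrightarrow> is_subst (comp_subst \<rho> \<sigma>)"
  by (simp add: is_subst_def comp_subst_def)

lemma wf_atom_subst [simp]: "is_subst \<sigma> \<Longrightarrow> wf_atom (subst_atom \<sigma> A) = wf_atom A"
  by (simp add: wf_atom_def is_subst_def)

lemma atoms_subst: "atoms (subst_clause \<sigma> C) = image_mset (subst_atom \<sigma>) (atoms C)"
  by (simp add: atoms_def subst_clause_def split: option.split)

lemma wf_clause_subst [simp]: "is_subst \<sigma> \<Longrightarrow> wf_clause (subst_clause \<sigma> C) = wf_clause C"
  by (simp add: wf_clause_iff atoms_subst)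

lemma body_size_subst [simp]: "body_size (subst_clause \<sigma> C) = body_size C"
  by (simp add: body_size_def subst_clause_def)

lemma tvars_subst: "tvars (subst_clause \<sigma> C) = on_tvar \<sigma> ` tvars C"
  by (auto simp: tvars_eq atoms_subst)

lemma pvars_subst: "pvars (subst_clause \<sigma> C) = on_pvar \<sigma> ` pvars C"
  by (simp add: pvars_eq atoms_subst image_image)

lemma finite_tvars [simp]: "finite (tvars C)"
  by (simp add: tvars_eq)

lemma finite_pvars [simp]: "finite (pvars C)"
  by (simp add: pvars_eq)

lemma subst_atom_cong:
  "on_pvar \<sigma> (pred A) = on_pvar \<tau> (pred A) \<Longrightarrow> (\<And>x. x \<in> av A \<Longrightarrow> on_tvar \<sigma> x = on_tvar \<tau> x)
    \<Longrightarrow> subst_atom \<sigma> A = subst_atom \<tau> A"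
  by (simp add: subst_atom_def av_def)

lemma subst_clause_cong:
  assumes "\<And>A. A \<in># atoms C \<Longrightarrow> subst_atom \<sigma> A = subst_atom \<tau> A"
  shows "subst_clause \<sigma> C = subst_clause \<tau> C"
  using assms by (auto simp: subst_clause_def set_atoms intro!: option.map_cong image_mset_cong)

text \<open>Repeated copies of an element yield as many copies of its image, and two elements with a
  common image give that image multiplicity two.\<close>

lemma count_image_mset_le_one:
  assumes "\<forall>y. count (image_mset f M) y \<le> 1"
  shows "count M x \<le> 1" and "inj_on f (set_mset M)"
proof -
  show "count M x \<le> 1"
  proof -
    have "replicate_mset (count M x) x \<subseteq># M" by (simp add: count_le_replicate_mset_subset_eq[symmetric])
    then have "replicate_mset (count M x) (f x) \<subseteq># image_mset f M"
      by (metis image_mset_subseteq_mono image_replicate_mset)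
    then have "count M x \<le> count (image_mset f M) (f x)"
      by (simp add: count_le_replicate_mset_subset_eq[symmetric])
    then show ?thesis using assms le_trans by blast
  qed
  show "inj_on f (set_mset M)"
  proof (rule inj_onI, rule ccontr)
    fix a b assume *: "a \<in># M" "b \<in># M" "f a = f b" "a \<noteq> b"
    then have "{#a, b#} \<subseteq># M"
      by (metis insert_DiffM insert_noteq_member insert_subset_eq_iff single_subset_iff)
    then have "{#f a, f b#} \<subseteq># image_mset f M"
      using image_mset_subseteq_mono[of "{#a, b#}" M f] by simp
    then have "count (image_mset f M) (f a) \<ge> 2"
      using *(3) by (auto dest: mset_subset_eq_count[of _ _ "f a"])
    then show False using assms by (metis One_nat_def Suc_n_not_le_n le_trans numeral_2_eq_2)
  qed
qed

lemma distinct_atoms_subst: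
  assumes "distinct_atoms (subst_clause \<sigma> C)"
  shows "distinct_atoms C" and "inj_on (subst_atom \<sigma>) (set_mset (atoms C))"
  using assms count_image_mset_le_one[of "subst_atom \<sigma>" "atoms C"]
  by (simp_all add: distinct_atoms_def atoms_subst)

section \<open>Renamings, most general clauses and unifiers\<close>

text \<open>As \<open>A\<close> and its image have equal size, the image points outside
  \<open>A\<close> can be matched with the points of \<open>A\<close> outside the image; all other
  points stay fixed.\<close>

lemma ex_bij_extending:
  fixes f :: "'a \<Rightarrow> 'a"
  assumes "finite A" "inj_on f A"
  shows "\<exists>g. bij g \<and> (\<forall>a\<in>A. g a = f a)"
proof -
  let ?B = "f ` A"
  have "card (?B - A) = card (A - ?B)"
    using assms by (intro antisym card_le_sym_Diff) (auto simp: card_image)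
  then obtain h where h: "bij_betw h (?B - A) (A - ?B)"
    using finite_same_card_bij[of "?B - A" "A - ?B"] assms(1) by auto
  define g where "g x = (if x \<in> A then f x else if x \<in> ?B then h x else x)" for x
  have "bij_betw g A ?B"
    using inj_on_imp_bij_betw[OF assms(2)] by (simp add: g_def cong: bij_betw_cong)
  moreover have "bij_betw g (?B - A) (A - ?B)"
    using h bij_betw_cong[of "?B - A" g h] by (auto simp: g_def)
  ultimately have "bij_betw g (A \<union> (?B - A)) (?B \<union> (A - ?B))"
    by (rule bij_betw_combine) blast
  moreover have "bij_betw g (- (A \<union> ?B)) (- (A \<union> ?B))"
    by (simp add: g_def bij_betw_def inj_on_def)
  ultimately have "bij_betw g ((A \<union> (?B - A)) \<union> - (A \<union> ?B)) ((?B \<union> (A - ?B)) \<union> - (A \<union> ?B))"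
    by (rule bij_betw_combine) blast
  moreover have "(A \<union> (?B - A)) \<union> - (A \<union> ?B) = UNIV" "(?B \<union> (A - ?B)) \<union> - (A \<union> ?B) = UNIV" by auto
  ultimately have "bij g" by simp
  then show ?thesis by (auto simp: g_def)
qed

text \<open>The predicate variables of each arity are treated separately, by a permutation of their
  names.\<close>

lemma ex_pvar_bij_extending:
  assumes "finite P" "inj_on f P" and ar: "\<And>p. arity (f p) = arity p"
  shows "\<exists>g. bij g \<and> (\<forall>p. arity (g p) = arity p) \<and> (\<forall>p\<in>P. g p = f p)"
proof -
  define P' where "P' n = {i. PVar i n \<in> P}" for n
  define f' where "f' n i = pname (f (PVar i n))" for n i
  have f: "f (PVar i n) = PVar (f' n i) n" for i n
    using ar[of "PVar i n"] by (cases "f (PVar i n)") (simp add: f'_def)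
  have "finite (P' n)" for n
    using finite_vimageI[OF assms(1), of "\<lambda>i. PVar i n"] by (auto simp: P'_def vimage_def inj_on_def)
  moreover have "inj_on (f' n) (P' n)" for n
    using assms(2) f by (force simp: inj_on_def P'_def)
  ultimately have "\<forall>n. \<exists>g. bij g \<and> (\<forall>i\<in>P' n. g i = f' n i)"
    by (blast intro: ex_bij_extending)
  then obtain g where g: "\<And>n. bij (g n)" "\<And>n i. i \<in> P' n \<Longrightarrow> g n i = f' n i" by metis
  let ?g = "\<lambda>p. PVar (g (arity p) (pname p)) (arity p)"
  have "bij ?g"
  proof (rule bijI)
    show "inj ?g" using g(1) by (auto simp: inj_on_def bij_def intro: pvar.expand)
    show "surj ?g"
    proof (rule surjI)
      fix p show "?g (PVar (inv (g (arity p)) (pname p)) (arity p)) = p"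
        using g(1) by (simp add: bij_is_surj surj_f_inv_f)
    qed
  qed
  moreover have "?g p = f p" if "p \<in> P" for p
    using g(2)[of "pname p" "arity p"] f[of "pname p" "arity p"] that by (simp add: P'_def)
  ultimately show ?thesis by (intro exI[of _ ?g]) auto
qed

text \<open>A renaming is a bijection on all variables, while constructions only provide maps
  injective on the variables of the clause at hand; extending these maps bridges the gap.\<close>

lemma variant_of_inj_subst:
  assumes "is_subst \<sigma>" "inj_on (on_pvar \<sigma>) (pvars C)" "inj_on (on_tvar \<sigma>) (tvars C)"
  shows "variant C (subst_clause \<sigma> C)"
proof -
  obtain g where g: "bij g" "\<And>p. arity (g p) = arity p" "\<And>p. p \<in> pvars C \<Longrightarrow> g p = on_pvar \<sigma> p"
    using ex_pvar_bij_extending[OF finite_pvars assms(2)] assms(1) by (auto simp: is_subst_def)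
  obtain h where h: "bij h" "\<And>x. x \<in> tvars C \<Longrightarrow> h x = on_tvar \<sigma> x"
    using ex_bij_extending[OF finite_tvars assms(3)] by blast
  have "subst_clause (Subst g h) C = subst_clause \<sigma> C"
    by (intro subst_clause_cong subst_atom_cong) (auto intro!: g h simp: tvars_eq pvars_eq)
  moreover have "is_renaming (Subst g h)" using g h by (simp add: is_renaming_def is_subst_def)
  ultimately show ?thesis unfolding variant_def by blast
qed

lemma inv_renaming:
  assumes "is_renaming \<rho>"
  defines "\<rho>' \<equiv> Subst (inv (on_pvar \<rho>)) (inv (on_tvar \<rho>))"
  shows "is_renaming \<rho>'" "subst_atom \<rho>' (subst_atom \<rho> A) = A"
    "subst_clause \<rho>' (subst_clause \<rho> C) = C"
proof -
  have b: "bij (on_pvar \<rho>)" "bij (on_tvar \<rho>)" "\<And>p. arity (on_pvar \<rho> p) = arity p"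
    using assms by (auto simp: is_renaming_def is_subst_def)
  have "arity (inv (on_pvar \<rho>) p) = arity p" for p
    using b by (metis bij_inv_eq_iff)
  then show "is_renaming \<rho>'"
    using b by (simp add: is_renaming_def is_subst_def \<rho>'_def bij_imp_bij_inv)
  show at: "subst_atom \<rho>' (subst_atom \<rho> A) = A" for A
    using b by (simp add: subst_atom_def \<rho>'_def bij_is_inj comp_def)
  show "subst_clause \<rho>' (subst_clause \<rho> C) = C"
    by (cases C) (simp add: subst_clause_def at option.map_comp comp_def image_mset.compositionality option.map_ident)
qed

lemma variant_sym: "variant C D \<Longrightarrow> variant D C"
  unfolding variant_def using inv_renaming(1,3) by metis

section \<open>Existence of most general generalisations\<close>

lemma card_tvars_le: "wf_clause C \<Longrightarrow> card (tvars C) \<le> (\<Sum>A\<in>#atoms C. arity (pred A))"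
proof -
  assume "wf_clause C"
  moreover have "card (\<Union>A\<in>set_mset M. av A) \<le> (\<Sum>A\<in>#M. arity (pred A))" if "\<forall>A\<in>#M. wf_atom A" for M
    using that
  proof (induction M)
    case (add A M)
    have "card (av A \<union> (\<Union>A\<in>set_mset M. av A)) \<le> card (av A) + card (\<Union>A\<in>set_mset M. av A)"
      by (rule card_Un_le)
    also have "card (av A) \<le> arity (pred A)"
      using add.prems by (auto simp: av_def wf_atom_def intro: order_trans[OF card_length])
    finally show ?case using add by auto
  qed simp
  ultimately show ?thesis by (simp add: tvars_eq wf_clause_iff)
qed

lemma card_pvars_le: "card (pvars C) \<le> size (atoms C)"
proof -
  have "card (pvars C) \<le> card (set_mset (atoms C))"
    unfolding pvars_eq by (rule card_image_le) simp
  also have "\<dots> = size (mset_set (set_mset (atoms C)))" by simp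
  also have "\<dots> \<le> size (atoms C)" by (rule size_mset_mono) (rule mset_set_set_mset_msubset)
  finally show ?thesis .
qed

text \<open>Among the generalisations of \<open>D\<close> in \<open>pre_fragment\<close>, one with
  the largest number of variables is most general: a substitution into it from a further
  generalisation cannot identify variables, as that one would have more of them.\<close>

lemma ex_most_general:
  assumes "D \<in> pre_fragment"
  shows "\<exists>D'\<in>H2c. \<exists>\<sigma>. is_subst \<sigma> \<and> subst_clause \<sigma> D' = D"
proof -
  let ?gen = "\<lambda>D'. D' \<in> pre_fragment \<and> (\<exists>\<sigma>. is_subst \<sigma> \<and> subst_clause \<sigma> D' = D)"
  let ?m = "\<lambda>D'. card (tvars D') + card (pvars D')"
  have "subst_atom (Subst id id) = id" by (simp add: fun_eq_iff subst_atom_def)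
  then have id: "subst_clause (Subst id id) E = E" for E
    by (cases E) (simp add: subst_clause_def option.map_id)
  have "?gen D" using assms id by (auto simp: is_subst_def intro!: exI[of _ "Subst id id"])
  \<comment> \<open>Substitutions preserve arities and the number of literals, which bounds the
    number of variables of all generalisations at once.\<close>
  moreover have "?m D' \<le> (\<Sum>A\<in>#atoms D. arity (pred A)) + size (atoms D)" if gen: "?gen D'" for D'
  proof -
    obtain \<sigma> where \<sigma>: "is_subst \<sigma>" "subst_clause \<sigma> D' = D" using gen by blast
    have "(\<Sum>A\<in>#atoms D. arity (pred A)) = (\<Sum>A\<in>#atoms D'. arity (pred A))" "size (atoms D) = size (atoms D')"
      using \<sigma> by (auto simp: atoms_subst image_mset.compositionality comp_def is_subst_def)
    moreover have "wf_clause D'" using gen by (simp add: pre_fragment_def)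
    ultimately show ?thesis using card_tvars_le[of D'] card_pvars_le[of D'] by simp
  qed
  ultimately obtain M where M: "?gen M" "\<And>D'. ?gen D' \<Longrightarrow> ?m D' \<le> ?m M"
    using ex_has_greatest_nat[of ?gen D ?m] by (metis (no_types, lifting) less_Suc_eq_le)
  obtain \<sigma> where \<sigma>: "is_subst \<sigma>" "subst_clause \<sigma> M = D" using M(1) by blast
  have "variant M E" if E: "E \<in> pre_fragment" "is_subst \<tau>" "subst_clause \<tau> E = M" for E \<tau>
  proof -
    \<comment> \<open>\<open>E\<close> also generalises \<open>D\<close>, so the maximality of
      \<open>M\<close> applies to it.\<close>
    have "?gen E" using E \<sigma> by (auto intro!: exI[of _ "comp_subst \<sigma> \<tau>"] simp: is_subst_comp subst_clause_comp)
    then have le: "?m E \<le> ?m M" by (rule M(2))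
    have M': "tvars M = on_tvar \<tau> ` tvars E" "pvars M = on_pvar \<tau> ` pvars E"
      using E by (auto simp: tvars_subst pvars_subst)
    have "card (tvars M) \<le> card (tvars E)" "card (pvars M) \<le> card (pvars E)"
      unfolding M' by (simp_all add: card_image_le)
    with le have "card (tvars M) = card (tvars E)" "card (pvars M) = card (pvars E)" by auto
    then have "inj_on (on_tvar \<tau>) (tvars E)" "inj_on (on_pvar \<tau>) (pvars E)"
      using M' by (simp_all add: eq_card_imp_inj_on)
    then have "variant E M" using variant_of_inj_subst[of \<tau> E] E by simp
    then show ?thesis by (rule variant_sym)
  qed
  then have "M \<in> H2c" using M(1) by (auto simp: H2c_eq most_general_def)
  then show ?thesis using \<sigma> by blast
qed

section \<open>Most general unifiers\<close>

text \<open>The condition \<open>t \<circ> s = t\<close> makes every unifier \<open>t\<close> factor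
  through \<open>s\<close> with \<open>t\<close> itself as the second factor. In the induction,
  \<open>s\<close> is followed by the map that redirects \<open>s y\<close> to
  \<open>s x\<close>.\<close>

lemma ex_unifying_map:
  fixes xs ys :: "'a list"
  assumes "length xs = length ys"
  shows "\<exists>s. map s xs = map s ys \<and> (\<forall>t :: 'a \<Rightarrow> 'b. map t xs = map t ys \<longrightarrow> t \<circ> s = t)"
  using assms
proof (induction xs ys rule: list_induct2)
  case Nil
  then show ?case by (auto intro: exI[of _ id])
next
  case (Cons x xs y ys)
  then obtain s where s: "map s xs = map s ys" "\<And>t :: 'a \<Rightarrow> 'b. map t xs = map t ys \<Longrightarrow> t \<circ> s = t" by blast
  let ?s = "(\<lambda>v. if v = s y then s x else v) \<circ> s"
  have "map ?s xs = map ?s ys" using s(1) by (metis list.map_comp)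
  moreover have "t \<circ> ?s = t" if "map t (x # xs) = map t (y # ys)" for t :: "'a \<Rightarrow> 'b"
    using that s(2)[of t] by (auto simp: fun_eq_iff) metis
  moreover have "?s x = ?s y" by simp
  ultimately show ?case by (intro exI[of _ ?s]) (simp only: list.map simp_thms, blast)
qed

text \<open>Unifiability provides equal arities and argument lengths. Then \<open>pred B\<close> is
  sent to \<open>pred A\<close>, and the argument lists are unified position by position.\<close>

lemma ex_mgu:
  assumes "unifier \<tau> A B"
  shows "\<exists>\<mu>. is_mgu \<mu> A B"
proof -
  have "arity (pred A) = arity (pred B)" "length (args A) = length (args B)"
    using assms by (auto simp: unifier_def is_subst_def subst_atom_def) (metis, metis length_map)
  moreover obtain s where s: "map s (args A) = map s (args B)"
    "\<And>t :: tvar \<Rightarrow> tvar. map t (args A) = map t (args B) \<Longrightarrow> t \<circ> s = t"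
    using ex_unifying_map calculation(2) by metis
  let ?\<mu> = "Subst (\<lambda>p. if p = pred B then pred A else p) s"
  have "unifier ?\<mu> A B"
    using s calculation(1) by (auto simp: unifier_def is_subst_def subst_atom_def)
  moreover have "\<tau> = comp_subst \<tau> ?\<mu>" if "unifier \<tau> A B" for \<tau>
    using that s(2)[of "on_tvar \<tau>"]
    by (cases \<tau>) (auto simp: unifier_def subst_atom_def comp_subst_def fun_eq_iff)
  ultimately show ?thesis unfolding is_mgu_def unifier_def by blast
qed

lemma H2c_pre_fragment: "C \<in> H2c \<Longrightarrow> C \<in> pre_fragment"
  by (simp add: H2c_eq most_general_def)

lemma H2c_variant:
  "C \<in> H2c \<Longrightarrow> D \<in> pre_fragment \<Longrightarrow> is_subst \<sigma> \<Longrightarrow> subst_clause \<sigma> D = C \<Longrightarrow> variant D C"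
  by (auto simp: H2c_eq most_general_def intro: variant_sym)

lemma ex_fresh_pvar: "finite P \<Longrightarrow> \<exists>i. PVar i n \<notin> P"
proof -
  assume "finite P"
  then have "finite ((\<lambda>i. PVar i n) -` P)" by (rule finite_vimageI) (simp add: inj_on_def)
  then show ?thesis by (metis UNIV_I finite_nat_set_iff_bounded less_irrefl vimage_eq ex_new_if_finite infinite_UNIV_nat)
qed

text \<open>Renaming the predicate variable of one of two equal atoms would give a more general clause.\<close>

lemma H2c_distinct_atoms:
  assumes C: "C \<in> H2c"
  shows "distinct_atoms C"
proof (rule ccontr)
  assume "\<not> distinct_atoms C"
  then obtain A where A: "count (atoms C) A \<ge> 2"
    unfolding distinct_atoms_def by (metis not_less_eq_eq numeral_2_eq_2 One_nat_def)
  \<comment> \<open>The head supplies at most one of the two copies, so there is a copy in the body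
    to rename.\<close>
  have "A \<in># body C"
  proof (rule ccontr)
    assume "A \<notin># body C"
    then have "count (atoms C) A \<le> 1" by (auto simp: atoms_def not_in_iff split: option.split)
    then show False using A by simp
  qed
  then obtain B where B: "body C = add_mset A B" by (metis insert_DiffM)
  define L where "L = (case head C of None \<Rightarrow> {#} | Some A \<Rightarrow> {#Pos A#}) + image_mset Neg B"
  have LC: "literals C = add_mset (Neg A) L"
    by (auto simp: literals_def L_def B split: option.split)
  have "count (atoms C) A = Suc (count (image_mset atom_of L) A)"
    by (simp add: atom_of_literals[symmetric] LC)
  then have AL: "A \<in># image_mset atom_of L" using A by (metis Suc_1 Suc_le_mono count_greater_eq_one_iff One_nat_def)
  obtain i where i: "PVar i (arity (pred A)) \<notin> pvars C" using ex_fresh_pvar[OF finite_pvars] by blast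
  define A' where "A' = Atom (PVar i (arity (pred A))) (args A)"
  define D where "D = Clause (head C) (add_mset A' B)"
  define \<sigma> where "\<sigma> = Subst (\<lambda>p. if p = pred A' then pred A else p) id"
  have \<sigma>: "is_subst \<sigma>" by (simp add: \<sigma>_def is_subst_def A'_def)
  have LD: "literals D = add_mset (Neg A') L"
    by (auto simp: literals_def L_def D_def split: option.split)
  have fresh: "pred A' \<noteq> pred X" if "X \<in># atoms C" for X
    using that i by (auto simp: pvars_eq A'_def)
  have "subst_atom \<sigma> A' = A" by (cases A) (simp add: \<sigma>_def A'_def subst_atom_def)
  moreover have id: "subst_atom \<sigma> X = X" if "X \<in># atoms C" for X
    using fresh[OF that] by (cases X) (simp add: \<sigma>_def subst_atom_def)
  moreover have "image_mset (subst_atom \<sigma>) B = image_mset id B"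
    using id by (intro image_mset_cong) (simp add: set_atoms B)
  moreover have "map_option (subst_atom \<sigma>) (head C) = head C"
    using id by (cases "head C") (auto simp: set_atoms)
  ultimately have DC: "subst_clause \<sigma> D = C"
    by (cases C) (use B in \<open>simp add: subst_clause_def D_def\<close>)
  have G: "wf_clause C" "connected C" "two_occurring C"
    using H2c_pre_fragment[OF C] by (auto simp: pre_fragment_def)
  have wfD: "wf_clause D" using G(1) DC \<sigma> by (metis wf_clause_subst)
  have "av A' = av A" by (simp add: A'_def av_def)
  then have avs: "av ` set_mset (atoms D) = av ` set_mset (atoms C)"
    by (simp add: set_atoms_literals LC LD)
  \<comment> \<open>Connectedness depends only on the variable sets of the atoms, which the renaming
    leaves unchanged.\<close>
  have conn_av: "conn K \<longleftrightarrow> (\<forall>S. (\<forall>V\<in>av ` K. V \<subseteq> S \<or> V \<inter> S = {}) \<longrightarrow>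
     (\<forall>V\<in>av ` K. V \<subseteq> S) \<or> (\<forall>V\<in>av ` K. V \<inter> S = {}))" for K
    by (simp add: conn_def)
  have "connected D"
    using connected_conn[OF G(2)] wfD conn_connected[of D] by (simp add: conn_av avs del: ball_simps)
  moreover have "two_occurring D" unfolding two_occurring_def
  proof
    fix x assume "x \<in> tvars D"
    then have "x \<in> tvars C" using avs by (simp add: tvars_eq)
    then obtain l k where lk: "l \<in># literals C" "k \<in># literals C" "l \<noteq> k" "x \<in> lit_tvars l" "x \<in> lit_tvars k"
      using G(3) by (auto simp: two_occurring_def)
    have xA': "x \<in> lit_tvars (Neg A')" if "x \<in> lit_tvars (Neg A)"
      using that by (simp add: lit_tvars_def A'_def)
    have nA': "m \<noteq> Neg A'" if "m \<in># L" for m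
      using fresh[of "atom_of m"] that by (auto simp: set_atoms_literals LC)
    show "\<exists>l\<in>#literals D. \<exists>k\<in>#literals D. l \<noteq> k \<and> x \<in> lit_tvars l \<and> x \<in> lit_tvars k"
    \<comment> \<open>If one of the two literals is \<open>Neg A\<close>, the other lies in
      \<open>L\<close> and is paired with \<open>Neg A'\<close>.\<close>
    proof (cases "l = Neg A \<or> k = Neg A")
      case True
      then obtain m where "m \<in># L" "x \<in> lit_tvars m" "x \<in> lit_tvars (Neg A')"
        using lk xA' by (auto simp: LC)
      then show ?thesis using nA' by (auto simp: LD)
    next
      case False
      then show ?thesis using lk by (auto simp: LC LD)
    qed
  qed
  ultimately have "D \<in> pre_fragment" using wfD by (simp add: pre_fragment_def)
  from H2c_variant[OF C this \<sigma> DC] obtain \<rho> where \<rho>: "is_renaming \<rho>" "subst_clause \<rho> D = C"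
    by (auto simp: variant_def)
  \<comment> \<open>Variants have equally many predicate variables, but \<open>D\<close> has one
    more than \<open>C\<close>: the other copy of \<open>A\<close> keeps \<open>pred A\<close> in
    use, and \<open>pred A'\<close> is new.\<close>
  have "pvars C = on_pvar \<rho> ` pvars D" using \<rho>(2) by (auto simp: pvars_subst)
  then have "card (pvars C) = card (pvars D)"
    using \<rho>(1) by (metis bij_is_inj card_image inj_on_subset is_renaming_def subset_UNIV)
  moreover have "pvars C = (pred \<circ> atom_of) ` set_mset L"
    using AL by (fastforce simp: pvars_eq set_atoms_literals LC)
  moreover have "pvars D = insert (pred A') ((pred \<circ> atom_of) ` set_mset L)"
    by (auto simp: pvars_eq set_atoms_literals LD)
  ultimately have "pvars D = insert (pred A') (pvars C)" "card (pvars C) = card (pvars D)" by auto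
  moreover have "pred A' \<notin> pvars C" using i by (simp add: A'_def)
  ultimately show False by simp
qed

section \<open>Lifting inferences to most general premises\<close>

text \<open>Shifting all names beyond a common bound separates the variables. The shift is not
  surjective, so a renaming with the same effect on \<open>D\<close> replaces it.\<close>

lemma ex_renaming_apart:
  assumes "finite P" "finite T"
  shows "\<exists>\<rho>. is_renaming \<rho> \<and> on_pvar \<rho> ` pvars D \<inter> P = {} \<and> on_tvar \<rho> ` tvars D \<inter> T = {}"
proof -
  obtain N where N: "\<And>t. t \<in> T \<Longrightarrow> t < N" "\<And>p. p \<in> P \<Longrightarrow> pname p < N"
  proof -
    have "finite (T \<union> pname ` P)" using assms by simp
    then obtain N where "\<forall>t\<in>T \<union> pname ` P. t < N" using finite_nat_set_iff_bounded by metis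
    then show thesis using that by blast
  qed
  let ?\<sigma> = "Subst (\<lambda>p. PVar (pname p + N) (arity p)) (\<lambda>t. t + N)"
  have "variant D (subst_clause ?\<sigma> D)"
    by (rule variant_of_inj_subst) (auto simp: is_subst_def inj_on_def intro: pvar.expand)
  then obtain \<rho> where \<rho>: "is_renaming \<rho>" "subst_clause \<rho> D = subst_clause ?\<sigma> D" by (auto simp: variant_def)
  have "on_pvar \<rho> ` pvars D = on_pvar ?\<sigma> ` pvars D" "on_tvar \<rho> ` tvars D = on_tvar ?\<sigma> ` tvars D"
    using \<rho>(2) by (metis pvars_subst, metis tvars_subst)
  moreover have "on_pvar ?\<sigma> ` pvars D \<inter> P = {}"
    using N(2) by (auto dest!: N(2))
  moreover have "on_tvar ?\<sigma> ` tvars D \<inter> T = {}"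
    by (auto dest!: N(1))
  ultimately show ?thesis using \<rho>(1) by (intro exI[of _ \<rho>]) simp
qed

text \<open>The lifting lemma: once \<open>C2\<close> is renamed apart, the two instantiations
  combine into one unifier of the resolved atoms, which factors through the mgu; the factor
  \<open>\<tau>\<close> recovers the given instances.\<close>

lemma resolve_lift:
  assumes C1: "body C1 = add_mset H1 XB" and C2: "head C2 = Some H2"
    and \<sigma>1: "is_subst \<sigma>1" and \<sigma>2: "is_subst \<sigma>2" and eq: "subst_atom \<sigma>1 H1 = subst_atom \<sigma>2 H2"
  obtains \<alpha>1 \<alpha>2 \<tau> where "is_subst \<alpha>1" "is_subst \<alpha>2" "is_subst \<tau>"
    "subst_atom \<alpha>1 H1 = subst_atom \<alpha>2 H2"
    "binary_resolvent C1 C2 (Clause (map_option (subst_atom \<alpha>1) (head C1))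
       (image_mset (subst_atom \<alpha>1) XB + image_mset (subst_atom \<alpha>2) (body C2)))"
    "\<And>A. A \<in># atoms C1 \<Longrightarrow> subst_atom \<tau> (subst_atom \<alpha>1 A) = subst_atom \<sigma>1 A"
    "\<And>A. A \<in># atoms C2 \<Longrightarrow> subst_atom \<tau> (subst_atom \<alpha>2 A) = subst_atom \<sigma>2 A"
proof -
  obtain \<rho> where \<rho>: "is_renaming \<rho>" and
    dj: "on_pvar \<rho> ` pvars C2 \<inter> pvars C1 = {}" "on_tvar \<rho> ` tvars C2 \<inter> tvars C1 = {}"
    using ex_renaming_apart[OF finite_pvars finite_tvars] by metis
  define \<rho>' where "\<rho>' = Subst (inv (on_pvar \<rho>)) (inv (on_tvar \<rho>))"
  have \<rho>': "is_renaming \<rho>'" "subst_atom \<rho>' (subst_atom \<rho> A) = A" for A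
    using inv_renaming[OF \<rho>] by (simp_all add: \<rho>'_def)
  define D where "D = subst_clause \<rho> C2"
  define \<sigma>2' where "\<sigma>2' = comp_subst \<sigma>2 \<rho>'"
  have \<sigma>2': "is_subst \<sigma>2'" "subst_atom \<sigma>2' (subst_atom \<rho> A) = subst_atom \<sigma>2 A" for A
    using \<rho>' \<sigma>2 by (auto simp: \<sigma>2'_def is_subst_comp is_renaming_def subst_atom_comp)
  \<comment> \<open>On the variables of \<open>C1\<close> this is \<open>\<sigma>1\<close>;
    elsewhere it undoes the renaming and then applies \<open>\<sigma>2\<close>.\<close>
  define \<theta> where "\<theta> = Subst (\<lambda>p. if p \<in> pvars C1 then on_pvar \<sigma>1 p else on_pvar \<sigma>2' p)
    (\<lambda>x. if x \<in> tvars C1 then on_tvar \<sigma>1 x else on_tvar \<sigma>2' x)"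
  have \<theta>: "is_subst \<theta>" using \<sigma>1 \<sigma>2' by (simp add: is_subst_def \<theta>_def)
  have \<theta>1: "subst_atom \<theta> A = subst_atom \<sigma>1 A" if "A \<in># atoms C1" for A
    using that by (intro subst_atom_cong) (auto simp: \<theta>_def pvars_eq tvars_eq)
  have \<theta>2: "subst_atom \<theta> (subst_atom \<rho> A) = subst_atom \<sigma>2 A" if "A \<in># atoms C2" for A
  proof -
    have "on_pvar \<rho> (pred A) \<notin> pvars C1" "\<And>x. x \<in> av A \<Longrightarrow> on_tvar \<rho> x \<notin> tvars C1"
      using dj that by (auto simp: pvars_eq[of C2] tvars_eq[of C2])
    then have "subst_atom \<theta> (subst_atom \<rho> A) = subst_atom \<sigma>2' (subst_atom \<rho> A)"
      by (intro subst_atom_cong) (auto simp: \<theta>_def)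
    then show ?thesis by (simp add: \<sigma>2')
  qed
  have H: "H1 \<in># atoms C1" "H2 \<in># atoms C2" by (simp_all add: set_atoms C1 C2)
  have un: "unifier \<theta> H1 (subst_atom \<rho> H2)"
    using \<theta> \<theta>1[OF H(1)] \<theta>2[OF H(2)] eq by (simp add: unifier_def)
  then obtain \<mu> where \<mu>: "is_mgu \<mu> H1 (subst_atom \<rho> H2)" using ex_mgu by blast
  with un obtain \<tau> where \<tau>: "is_subst \<tau>" "\<theta> = comp_subst \<tau> \<mu>" by (auto simp: is_mgu_def)
  have "is_subst \<mu>" using \<mu> by (simp add: is_mgu_def unifier_def)
  moreover have "is_subst (comp_subst \<mu> \<rho>)" using calculation \<rho> by (simp add: is_subst_comp is_renaming_def)
  moreover have "subst_atom \<mu> H1 = subst_atom (comp_subst \<mu> \<rho>) H2"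
    using \<mu> by (simp add: is_mgu_def unifier_def subst_atom_comp)
  moreover have "binary_resolvent C1 C2 (Clause (map_option (subst_atom \<mu>) (head C1))
       (image_mset (subst_atom \<mu>) XB + image_mset (subst_atom (comp_subst \<mu> \<rho>)) (body C2)))"
  proof -
    have "variant C2 D" using \<rho> by (auto simp: variant_def D_def)
    moreover have "tvars C1 \<inter> tvars D = {}" "pvars C1 \<inter> pvars D = {}"
      using dj by (auto simp: D_def tvars_subst pvars_subst)
    moreover have "H1 \<in># body C1" "head D = Some (subst_atom \<rho> H2)"
      by (simp_all add: C1 C2 D_def subst_clause_def)
    moreover have "subst_atom (comp_subst \<mu> \<rho>) = subst_atom \<mu> \<circ> subst_atom \<rho>"
      by (simp add: fun_eq_iff subst_atom_comp)
    then have "Clause (map_option (subst_atom \<mu>) (head C1))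
       (image_mset (subst_atom \<mu>) XB + image_mset (subst_atom (comp_subst \<mu> \<rho>)) (body C2))
       = subst_clause \<mu> (Clause (head C1) ((body C1 - {#H1#}) + body D))"
      by (simp add: subst_clause_def C1 D_def image_mset.compositionality)
    ultimately show ?thesis unfolding binary_resolvent_def using \<mu> by blast
  qed
  moreover have "subst_atom \<tau> (subst_atom \<mu> A) = subst_atom \<sigma>1 A" if "A \<in># atoms C1" for A
    using \<theta>1[OF that] by (simp add: \<tau>(2) subst_atom_comp)
  moreover have "subst_atom \<tau> (subst_atom (comp_subst \<mu> \<rho>) A) = subst_atom \<sigma>2 A" if "A \<in># atoms C2" for A
    using \<theta>2[OF that] by (simp add: \<tau>(2) subst_atom_comp)
  ultimately show thesis using that \<tau>(1) by blast
qed

section \<open>Connectedness and double occurrence in resolvents\<close>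

text \<open>The preimage of a set that no image atom straddles is not straddled by the original
  atoms.\<close>

lemma conn_image:
  assumes "conn K"
  shows "conn (subst_atom \<sigma> ` K)"
  unfolding conn_def
proof (intro allI impI)
  fix S assume *: "\<forall>A\<in>subst_atom \<sigma> ` K. av A \<subseteq> S \<or> av A \<inter> S = {}"
  let ?S = "on_tvar \<sigma> -` S"
  have eq: "av (subst_atom \<sigma> A) \<subseteq> S \<longleftrightarrow> av A \<subseteq> ?S" "av (subst_atom \<sigma> A) \<inter> S = {} \<longleftrightarrow> av A \<inter> ?S = {}" for A
    by auto
  have "\<forall>A\<in>K. av A \<subseteq> ?S \<or> av A \<inter> ?S = {}" using * eq by blast
  then have "(\<forall>A\<in>K. av A \<subseteq> ?S) \<or> (\<forall>A\<in>K. av A \<inter> ?S = {})" using assms unfolding conn_def by blast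
  then show "(\<forall>A\<in>subst_atom \<sigma> ` K. av A \<subseteq> S) \<or> (\<forall>A\<in>subst_atom \<sigma> ` K. av A \<inter> S = {})"
    using eq by blast
qed

text \<open>\<open>K2\<close> lies on one side of \<open>S\<close>. All variables of
  \<open>H\<close> occur in \<open>K2\<close>, so \<open>H\<close> lies on the same side and carries
  it over to \<open>K1\<close>.\<close>

lemma conn_glue:
  assumes "conn (insert H K1)" "conn K2" "av H \<noteq> {}" "av H \<subseteq> (\<Union>A\<in>K2. av A)"
  shows "conn (K1 \<union> K2)"
  unfolding conn_def
proof (intro allI impI)
  fix S assume *: "\<forall>A\<in>K1 \<union> K2. av A \<subseteq> S \<or> av A \<inter> S = {}"
  then have K2: "(\<forall>A\<in>K2. av A \<subseteq> S) \<or> (\<forall>A\<in>K2. av A \<inter> S = {})"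
    using assms(2) unfolding conn_def by blast
  then have H: "av H \<subseteq> S \<or> av H \<inter> S = {}" using assms(4) by blast
  have "\<forall>A\<in>insert H K1. av A \<subseteq> S \<or> av A \<inter> S = {}" using * H by blast
  then have K1: "(\<forall>A\<in>insert H K1. av A \<subseteq> S) \<or> (\<forall>A\<in>insert H K1. av A \<inter> S = {})"
    using assms(1) unfolding conn_def by blast
  show "(\<forall>A\<in>K1 \<union> K2. av A \<subseteq> S) \<or> (\<forall>A\<in>K1 \<union> K2. av A \<inter> S = {})"
    using K2
  proof
    assume "\<forall>A\<in>K2. av A \<subseteq> S"
    moreover from this have "av H \<inter> S \<noteq> {}" using assms(3,4) by blast
    then have "\<forall>A\<in>K1. av A \<subseteq> S" using K1 by blast
    ultimately show ?thesis by blast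
  next
    assume "\<forall>A\<in>K2. av A \<inter> S = {}"
    moreover from this have "\<not> av H \<subseteq> S" using assms(3,4) by blast
    then have "\<forall>A\<in>K1. av A \<inter> S = {}" using K1 by blast
    ultimately show ?thesis by blast
  qed
qed

text \<open>A variable whose second occurrence was in the resolved atom finds a new one across it,
  in the other premise. The atom found there can coincide with the given one only if the two are
  merged, and \<open>overlap\<close> keeps merged atoms away from the variables of the resolved
  atom.\<close>

lemma two_occ_glue:
  assumes two: "two_occ (insert H1 K1)" "two_occ (insert H2 K2)"
    and H: "subst_atom \<alpha>1 H1 = subst_atom \<alpha>2 H2"
    and inj: "inj_on (subst_atom \<alpha>1) K1" "inj_on (subst_atom \<alpha>2) K2" and "H1 \<notin> K1" "H2 \<notin> K2"
    and overlap: "\<And>B1 B2. B1 \<in> K1 \<Longrightarrow> B2 \<in> K2 \<Longrightarrow> subst_atom \<alpha>1 B1 = subst_atom \<alpha>2 B2 \<Longrightarrow>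
      av B1 \<inter> av H1 = {} \<and> av B2 \<inter> av H2 = {}"
  shows "two_occ (subst_atom \<alpha>1 ` K1 \<union> subst_atom \<alpha>2 ` K2)"
proof -
  \<comment> \<open>One direction for arbitrary data, so that it can be used again with the premises
    exchanged.\<close>
  have half: "\<exists>B'\<in>subst_atom \<alpha> ` K \<union> subst_atom \<beta> ` L. B' \<noteq> subst_atom \<alpha> B \<and> on_tvar \<alpha> x \<in> av B'"
    if K: "two_occ (insert H K)" and L: "two_occ (insert J L)"
      and HJ: "subst_atom \<alpha> H = subst_atom \<beta> J"
      and inj: "inj_on (subst_atom \<alpha>) K" and "J \<notin> L" and B: "B \<in> K" "x \<in> av B"
      and ov: "\<And>B1 B2. B1 \<in> K \<Longrightarrow> B2 \<in> L \<Longrightarrow> subst_atom \<alpha> B1 = subst_atom \<beta> B2 \<Longrightarrow> av B1 \<inter> av H = {}"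
    for \<alpha> \<beta> K L H J B x
  proof -
    obtain B' where B': "B' \<in> insert H K" "B' \<noteq> B" "x \<in> av B'"
      using K B unfolding two_occ_def by blast
    show ?thesis
    proof (cases "B' \<in> K")
      case True
      then have "subst_atom \<alpha> B' \<noteq> subst_atom \<alpha> B" using inj B(1) B'(2) by (meson inj_onD)
      then show ?thesis using True B'(3) by (intro bexI[of _ "subst_atom \<alpha> B'"]) auto
    next
      case False
      then have xH: "x \<in> av H" using B' by auto
      then have "on_tvar \<alpha> x \<in> av (subst_atom \<beta> J)" using HJ by (metis av_subst imageI)
      then obtain z where z: "z \<in> av J" "on_tvar \<alpha> x = on_tvar \<beta> z" by auto
      then obtain B2 where B2: "B2 \<in> L" "z \<in> av B2" using L \<open>J \<notin> L\<close> unfolding two_occ_def by blast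
      have "subst_atom \<beta> B2 \<noteq> subst_atom \<alpha> B" using ov[OF B(1) B2(1)] xH B(2) by auto
      then show ?thesis using B2 z by (intro bexI[of _ "subst_atom \<beta> B2"]) auto
    qed
  qed
  have 1: "\<exists>B'\<in>subst_atom \<alpha>1 ` K1 \<union> subst_atom \<alpha>2 ` K2. B' \<noteq> subst_atom \<alpha>1 B \<and> on_tvar \<alpha>1 x \<in> av B'"
    if "B \<in> K1" "x \<in> av B" for B x
    by (rule half[OF two H inj(1)]) (use assms that in auto)
  have 2: "\<exists>B'\<in>subst_atom \<alpha>2 ` K2 \<union> subst_atom \<alpha>1 ` K1. B' \<noteq> subst_atom \<alpha>2 B \<and> on_tvar \<alpha>2 x \<in> av B'"
    if "B \<in> K2" "x \<in> av B" for B x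
    by (rule half[OF two(2) two(1) H[symmetric] inj(2)]) (use assms that in \<open>metis+\<close>)
  show ?thesis unfolding two_occ_def using 1 2 by (auto simp: Un_commute)
qed

lemma distinct_atoms_disjoint:
  assumes "distinct_atoms C" "body C = add_mset A B"
  shows "A \<notin> set_option (head C)" "A \<notin># B"
proof -
  have "count (atoms C) A \<le> 1" using assms(1) by (simp add: distinct_atoms_def)
  then show "A \<notin> set_option (head C)" "A \<notin># B"
    by (auto simp: atoms_def assms(2) not_in_iff split: option.splits)
qed

text \<open>It suffices that the premises belong to the fragment before restriction to most general
  clauses: their most general generalisations resolve, after the same factoring step, to a clause
  of the fragment that generalises the most general clause \<open>C\<close> and hence is a variant of it.\<close>

lemma std_resolution_lift:
  assumes C: "C \<in> H2c"
    and C1: "C1 \<in> pre_fragment" "distinct_atoms C1" "\<And>A. A \<in># atoms C1 \<Longrightarrow> arity (pred A) \<le> 2"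
      "head C1 = head C" "body C1 = add_mset H XB" "body_size C1 < body_size C"
    and C2: "C2 \<in> pre_fragment" "distinct_atoms C2" "\<And>A. A \<in># atoms C2 \<Longrightarrow> arity (pred A) \<le> 2"
      "head C2 = Some H" "body_size C2 < body_size C"
    and overlap: "body C = XB + body C2 \<or>
      (\<exists>M X0 Y0. XB = add_mset M X0 \<and> body C2 = add_mset M Y0 \<and>
         body C = add_mset M (X0 + Y0) \<and> av M \<inter> av H = {})"
    and conn2: "\<And>D \<sigma>. D \<in> pre_fragment \<Longrightarrow> is_subst \<sigma> \<Longrightarrow> subst_clause \<sigma> D = C2 \<Longrightarrow>
      conn (set_mset (body D))"
  shows "\<exists>b'<body_size C. \<exists>D1\<in>bounded H2c 2 (enat b'). \<exists>D2\<in>bounded H2c 2 (enat b').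
    std_resolution D1 D2 C"
proof -
  obtain D1 \<sigma>1 where D1: "D1 \<in> H2c" and \<sigma>1: "is_subst \<sigma>1" "subst_clause \<sigma>1 D1 = C1"
    using ex_most_general[OF C1(1)] by blast
  obtain D2 \<sigma>2 where D2: "D2 \<in> H2c" and \<sigma>2: "is_subst \<sigma>2" "subst_clause \<sigma>2 D2 = C2"
    using ex_most_general[OF C2(1)] by blast
  have "image_mset (subst_atom \<sigma>1) (body D1) = add_mset H XB"
    using \<sigma>1(2) C1(5) by (auto simp: subst_clause_def)
  then obtain H1 X where X: "body D1 = add_mset H1 X" "subst_atom \<sigma>1 H1 = H"
    "image_mset (subst_atom \<sigma>1) X = XB"
    by (metis msed_map_invR)
  have h1: "map_option (subst_atom \<sigma>1) (head D1) = head C"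
    using \<sigma>1(2) C1(4) by (auto simp: subst_clause_def)
  obtain H2 where H2: "head D2 = Some H2" "subst_atom \<sigma>2 H2 = H"
    using \<sigma>2(2) C2(4) by (auto simp: subst_clause_def)
  have Y: "image_mset (subst_atom \<sigma>2) (body D2) = body C2"
    using \<sigma>2(2) by (auto simp: subst_clause_def)
  obtain \<alpha>1 \<alpha>2 \<tau> where \<alpha>: "is_subst \<alpha>1" "is_subst \<alpha>2" "is_subst \<tau>"
    and H\<alpha>: "subst_atom \<alpha>1 H1 = subst_atom \<alpha>2 H2"
    and res: "binary_resolvent D1 D2 (Clause (map_option (subst_atom \<alpha>1) (head D1))
       (image_mset (subst_atom \<alpha>1) X + image_mset (subst_atom \<alpha>2) (body D2)))"
    and \<tau>1: "\<And>A. A \<in># atoms D1 \<Longrightarrow> subst_atom \<tau> (subst_atom \<alpha>1 A) = subst_atom \<sigma>1 A"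
    and \<tau>2: "\<And>A. A \<in># atoms D2 \<Longrightarrow> subst_atom \<tau> (subst_atom \<alpha>2 A) = subst_atom \<sigma>2 A"
    using resolve_lift[OF X(1) H2(1) \<sigma>1(1) \<sigma>2(1)] X(2) H2(2) by metis
  let ?R = "Clause (map_option (subst_atom \<alpha>1) (head D1))
       (image_mset (subst_atom \<alpha>1) X + image_mset (subst_atom \<alpha>2) (body D2))"
  have dC: "distinct_atoms C" by (rule H2c_distinct_atoms[OF C])
  have C_pre: "C \<in> pre_fragment" by (rule H2c_pre_fragment[OF C])
  have sub: "set_option (head D1) \<subseteq> set_mset (atoms D1)" "set_mset X \<subseteq> set_mset (atoms D1)"
    "set_mset (body D2) \<subseteq> set_mset (atoms D2)" "H1 \<in># atoms D1" "H2 \<in># atoms D2"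
    by (auto simp: set_atoms X(1) H2(1))
  \<comment> \<open>Both alternatives of \<open>overlap\<close> are brought to one form:
    \<open>E\<close> is the resolvent, factored once in the second alternative;
    \<open>\<beta>1\<close> and \<open>\<beta>2\<close> lead from the premises to \<open>E\<close>,
    and \<open>\<tau>'\<close> leads on to \<open>C\<close>. The last conjunct controls the atoms
    that come from both premises.\<close>
  have "\<exists>E \<beta>1 \<beta>2 \<tau>'. factor\<^sup>*\<^sup>* ?R E \<and> is_subst \<beta>1 \<and> is_subst \<beta>2 \<and> is_subst \<tau>' \<and>
      subst_atom \<beta>1 H1 = subst_atom \<beta>2 H2 \<and>
      (\<forall>A\<in>#atoms D1. subst_atom \<tau>' (subst_atom \<beta>1 A) = subst_atom \<sigma>1 A) \<and>
      (\<forall>A\<in>#atoms D2. subst_atom \<tau>' (subst_atom \<beta>2 A) = subst_atom \<sigma>2 A) \<and>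
      subst_clause \<tau>' E = C \<and>
      set_mset (atoms E) = subst_atom \<beta>1 ` (set_option (head D1) \<union> set_mset X) \<union>
        subst_atom \<beta>2 ` set_mset (body D2) \<and>
      (\<forall>Z \<in> set_option (head C) \<union> set_mset XB. Z \<in># body C2 \<longrightarrow> av Z \<inter> av H = {})"
    using overlap
  proof (elim disjE exE conjE)
    assume bC: "body C = XB + body C2"
    have "Z \<notin># body C2" if "Z \<in> set_option (head C) \<union> set_mset XB" for Z
    proof
      assume "Z \<in># body C2"
      then obtain B where "body C2 = add_mset Z B" by (metis insert_DiffM)
      with distinct_atoms_disjoint[OF dC, of Z "XB + B"] bC that show False by auto
    qed
    moreover have "subst_clause \<tau> ?R = C"
    proof -
      have "image_mset (subst_atom \<tau>) (image_mset (subst_atom \<alpha>1) X) = XB"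
        unfolding X(3)[symmetric] image_mset.compositionality
        by (rule image_mset_cong) (use \<tau>1 sub in auto)
      moreover have "image_mset (subst_atom \<tau>) (image_mset (subst_atom \<alpha>2) (body D2)) = body C2"
        unfolding Y[symmetric] image_mset.compositionality
        by (rule image_mset_cong) (use \<tau>2 sub in auto)
      moreover have "map_option (subst_atom \<tau>) (map_option (subst_atom \<alpha>1) (head D1)) = head C"
        unfolding h1[symmetric] option.map_comp by (rule option.map_cong) (use \<tau>1 sub in auto)
      ultimately show ?thesis using bC by (cases C) (simp add: subst_clause_def)
    qed
    moreover have "set_mset (atoms ?R) = subst_atom \<alpha>1 ` (set_option (head D1) \<union> set_mset X) \<union>
        subst_atom \<alpha>2 ` set_mset (body D2)"
      by (auto simp: set_atoms option.set_map)
    ultimately show ?thesis using \<alpha> H\<alpha> \<tau>1 \<tau>2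
      by (intro exI[of _ ?R] exI[of _ \<alpha>1] exI[of _ \<alpha>2] exI[of _ \<tau>]) blast
  next
    fix M X0 Y0 assume M: "XB = add_mset M X0" "body C2 = add_mset M Y0"
      "body C = add_mset M (X0 + Y0)" "av M \<inter> av H = {}"
    have disj: "Z \<notin># Y0" if "Z \<in> set_option (head C) \<union> set_mset XB" for Z
    proof
      assume "Z \<in># Y0"
      then obtain B where B: "Y0 = add_mset Z B" by (metis insert_DiffM)
      with distinct_atoms_disjoint[OF dC, of Z "add_mset M (X0 + B)"] M that show False by auto
    qed
    obtain M1 X' where X': "X = add_mset M1 X'" "subst_atom \<sigma>1 M1 = M" "image_mset (subst_atom \<sigma>1) X' = X0"
      using X(3) M(1) by (metis msed_map_invR)
    obtain M2 Y' where Y': "body D2 = add_mset M2 Y'" "subst_atom \<sigma>2 M2 = M" "image_mset (subst_atom \<sigma>2) Y' = Y0"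
      using Y M(2) by (metis msed_map_invR)
    \<comment> \<open>The two preimages of \<open>M\<close> have a common instance under
      \<open>\<tau>\<close>, so they can be factored, and \<open>\<tau>\<close> itself factors
      through their mgu.\<close>
    have "unifier \<tau> (subst_atom \<alpha>1 M1) (subst_atom \<alpha>2 M2)"
      using \<tau>1[of M1] \<tau>2[of M2] sub \<alpha>(3) by (auto simp: unifier_def X' Y')
    moreover from ex_mgu[OF this] obtain \<nu> where \<nu>: "is_mgu \<nu> (subst_atom \<alpha>1 M1) (subst_atom \<alpha>2 M2)"
      by blast
    ultimately obtain \<tau>' where \<tau>': "is_subst \<tau>'" "\<tau> = comp_subst \<tau>' \<nu>" by (auto simp: is_mgu_def)
    have \<nu>': "is_subst \<nu>" "subst_atom \<nu> (subst_atom \<alpha>1 M1) = subst_atom \<nu> (subst_atom \<alpha>2 M2)"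
      using \<nu> by (auto simp: is_mgu_def unifier_def)
    define \<beta>1 \<beta>2 where "\<beta>1 = comp_subst \<nu> \<alpha>1" and "\<beta>2 = comp_subst \<nu> \<alpha>2"
    have \<beta>: "subst_atom \<beta>1 = subst_atom \<nu> \<circ> subst_atom \<alpha>1" "subst_atom \<beta>2 = subst_atom \<nu> \<circ> subst_atom \<alpha>2"
      by (simp_all add: fun_eq_iff \<beta>1_def \<beta>2_def subst_atom_comp)
    define E where "E = Clause (map_option (subst_atom \<beta>1) (head D1))
       (image_mset (subst_atom \<beta>1) X + image_mset (subst_atom \<beta>2) Y')"
    have "factor ?R E"
    proof -
      have "{#subst_atom \<alpha>1 M1, subst_atom \<alpha>2 M2#} \<subseteq># body ?R"
        by (simp add: X' Y')
      moreover have "E = subst_clause \<nu> (Clause (head ?R) (body ?R - {#subst_atom \<alpha>2 M2#}))"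
        by (simp add: E_def subst_clause_def \<beta> option.map_comp image_mset.compositionality Y')
      ultimately show ?thesis unfolding factor_def using \<nu> by blast
    qed
    moreover have \<tau>1': "subst_atom \<tau>' (subst_atom \<beta>1 A) = subst_atom \<sigma>1 A" if "A \<in># atoms D1" for A
      using \<tau>1[OF that] by (simp add: \<beta> \<tau>'(2) subst_atom_comp)
    moreover have \<tau>2': "subst_atom \<tau>' (subst_atom \<beta>2 A) = subst_atom \<sigma>2 A" if "A \<in># atoms D2" for A
      using \<tau>2[OF that] by (simp add: \<beta> \<tau>'(2) subst_atom_comp)
    moreover have "subst_clause \<tau>' E = C"
    proof -
      have "image_mset (subst_atom \<tau>') (image_mset (subst_atom \<beta>1) X) = XB"
        unfolding X(3)[symmetric] image_mset.compositionality
        by (rule image_mset_cong) (use \<tau>1' sub in auto)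
      moreover have "image_mset (subst_atom \<tau>') (image_mset (subst_atom \<beta>2) Y') = Y0"
        unfolding Y'(3)[symmetric] image_mset.compositionality
        by (rule image_mset_cong) (use \<tau>2' sub Y'(1) in auto)
      moreover have "map_option (subst_atom \<tau>') (map_option (subst_atom \<beta>1) (head D1)) = head C"
        unfolding h1[symmetric] option.map_comp by (rule option.map_cong) (use \<tau>1' sub in auto)
      ultimately show ?thesis using M by (cases C) (simp add: subst_clause_def E_def)
    qed
    moreover have "set_mset (atoms E) = subst_atom \<beta>1 ` (set_option (head D1) \<union> set_mset X) \<union>
        subst_atom \<beta>2 ` set_mset (body D2)"
      using \<nu>'(2) by (auto simp: set_atoms option.set_map E_def X' Y' \<beta>)
    moreover have "\<forall>Z \<in> set_option (head C) \<union> set_mset XB. Z \<in># body C2 \<longrightarrow> av Z \<inter> av H = {}"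
      using disj M(2,4) by auto
    moreover have "is_subst \<beta>1" "is_subst \<beta>2" using \<nu>'(1) \<alpha> by (simp_all add: \<beta>1_def \<beta>2_def is_subst_comp)
    moreover have "subst_atom \<beta>1 H1 = subst_atom \<beta>2 H2" using H\<alpha> by (simp add: \<beta>)
    ultimately show ?thesis using \<tau>'(1)
      by (intro exI[of _ E] exI[of _ \<beta>1] exI[of _ \<beta>2] exI[of _ \<tau>']) blast
  qed
  then obtain E \<beta>1 \<beta>2 \<tau>' where E: "factor\<^sup>*\<^sup>* ?R E" "is_subst \<beta>1" "is_subst \<beta>2" "is_subst \<tau>'"
      "subst_atom \<beta>1 H1 = subst_atom \<beta>2 H2"
      and \<tau>': "\<And>A. A \<in># atoms D1 \<Longrightarrow> subst_atom \<tau>' (subst_atom \<beta>1 A) = subst_atom \<sigma>1 A"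
      "\<And>A. A \<in># atoms D2 \<Longrightarrow> subst_atom \<tau>' (subst_atom \<beta>2 A) = subst_atom \<sigma>2 A"
      and EC: "subst_clause \<tau>' E = C"
      and at: "set_mset (atoms E) = subst_atom \<beta>1 ` (set_option (head D1) \<union> set_mset X) \<union>
        subst_atom \<beta>2 ` set_mset (body D2)"
      and ov: "\<And>Z. Z \<in> set_option (head C) \<union> set_mset XB \<Longrightarrow> Z \<in># body C2 \<Longrightarrow> av Z \<inter> av H = {}"
    by metis
  let ?K1 = "set_option (head D1) \<union> set_mset X" and ?K2 = "set_mset (body D2)"
  have K1: "set_mset (atoms D1) = insert H1 ?K1" and K2: "set_mset (atoms D2) = insert H2 ?K2"
    by (auto simp: set_atoms X(1) H2(1))
  have dD: "distinct_atoms D1" "distinct_atoms D2"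
    using D1 D2 H2c_distinct_atoms by blast+
  have pD: "D1 \<in> pre_fragment" "D2 \<in> pre_fragment"
    using D1 D2 H2c_pre_fragment by blast+
  have "H1 \<notin> ?K1" using distinct_atoms_disjoint[OF dD(1) X(1)] by simp
  have "H2 \<notin> ?K2"
  proof
    assume "H2 \<in> ?K2"
    then obtain B where "body D2 = add_mset H2 B" by (metis insert_DiffM)
    from distinct_atoms_disjoint(1)[OF dD(2) this] show False using H2(1) by simp
  qed
  have inj: "inj_on (subst_atom \<sigma>1) (set_mset (atoms D1))" "inj_on (subst_atom \<sigma>2) (set_mset (atoms D2))"
    using distinct_atoms_subst(2) \<sigma>1(2) \<sigma>2(2) C1(2) C2(2) by blast+
  \<comment> \<open>Followed by \<open>\<tau>'\<close>, this map becomes \<open>\<sigma>1\<close>,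
    which is injective because \<open>C1\<close> has distinct atoms; likewise for
    \<open>\<beta>2\<close>.\<close>
  have "inj_on (subst_atom \<beta>1) ?K1"
    by (rule inj_onI) (metis K1 inj(1) inj_onD insertCI \<tau>'(1))
  moreover have "inj_on (subst_atom \<beta>2) ?K2"
    by (rule inj_onI) (metis K2 inj(2) inj_onD insertCI \<tau>'(2))
  moreover have two: "two_occ (insert H1 ?K1)" "two_occ (insert H2 ?K2)"
    using pre_fragment_two_occ[OF pD(1) dD(1)] pre_fragment_two_occ[OF pD(2) dD(2)] K1 K2 by simp_all
  moreover have "av B1 \<inter> av H1 = {} \<and> av B2 \<inter> av H2 = {}"
    if B: "B1 \<in> ?K1" "B2 \<in> ?K2" and eq: "subst_atom \<beta>1 B1 = subst_atom \<beta>2 B2" for B1 B2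
  proof -
    have eq': "subst_atom \<sigma>1 B1 = subst_atom \<sigma>2 B2"
      using \<tau>'(1)[of B1] \<tau>'(2)[of B2] B eq K1 K2 by auto
    have "subst_atom \<sigma>1 B1 \<in> set_option (head C) \<union> set_mset XB"
      using B(1) by (auto simp: h1[symmetric] X(3)[symmetric] option.set_map)
    moreover have "subst_atom \<sigma>1 B1 \<in># body C2" using B(2) eq' by (simp add: Y[symmetric])
    ultimately have "av (subst_atom \<sigma>1 B1) \<inter> av H = {}" by (rule ov)
    then have "av (subst_atom \<sigma>1 B1) \<inter> av (subst_atom \<sigma>1 H1) = {}"
      "av (subst_atom \<sigma>2 B2) \<inter> av (subst_atom \<sigma>2 H2) = {}"
      using eq' X(2) H2(2) by simp_all
    then show ?thesis by auto
  qed
  ultimately have twoE: "two_occ (set_mset (atoms E))"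
    unfolding at using E(5) \<open>H1 \<notin> ?K1\<close> \<open>H2 \<notin> ?K2\<close> by (intro two_occ_glue) auto
  have wf: "wf_clause E" "wf_clause D1"
    using C_pre EC E(4) pD(1) by (auto simp: pre_fragment_def)
  have connE: "conn (set_mset (atoms E))"
    unfolding at
  proof (rule conn_glue)
    have "conn (subst_atom \<beta>1 ` insert H1 ?K1)"
      using connected_conn[of D1] pD(1) K1 by (intro conn_image) (simp add: pre_fragment_def)
    then show "conn (insert (subst_atom \<beta>1 H1) (subst_atom \<beta>1 ` ?K1))" by simp
    \<comment> \<open>Losing its head may disconnect a clause. As \<open>D2\<close> is only known to
      be some generalisation of \<open>C2\<close>, the hypothesis \<open>conn2\<close> speaks about
      all of them.\<close>
    show "conn (subst_atom \<beta>2 ` ?K2)"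
      using conn2[OF pD(2) \<sigma>2] by (rule conn_image)
    show "av (subst_atom \<beta>1 H1) \<noteq> {}"
      using wf(2) sub(4) wf_atom_av[of H1] by (simp add: wf_clause_iff)
    have "av H2 \<subseteq> (\<Union>A\<in>?K2. av A)"
      using two(2) unfolding two_occ_def by blast
    then show "av (subst_atom \<beta>1 H1) \<subseteq> (\<Union>A\<in>subst_atom \<beta>2 ` ?K2. av A)"
      unfolding E(5) by auto
  qed
  have "variant E C"
    using H2c_variant[OF C pre_fragmentI[OF wf(1) connE twoE] E(4) EC] .
  then have "std_resolution D1 D2 C"
    unfolding std_resolution_def using res E(1) by blast
  moreover have "D1 \<in> bounded H2c 2 (enat (body_size C - 1))"
  proof -
    have "arity (pred A) \<le> 2" if "A \<in># atoms D1" for A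
      using C1(3)[of "subst_atom \<sigma>1 A"] that \<sigma>1 by (auto simp: atoms_subst is_subst_def)
    moreover have "body_size D1 = body_size C1" using \<sigma>1(2) by auto
    ultimately show ?thesis using D1 C1(6)
      by (auto simp: bounded_def numeral_eq_enat set_atoms_literals)
  qed
  moreover have "D2 \<in> bounded H2c 2 (enat (body_size C - 1))"
  proof -
    have "arity (pred A) \<le> 2" if "A \<in># atoms D2" for A
      using C2(3)[of "subst_atom \<sigma>2 A"] that \<sigma>2 by (auto simp: atoms_subst is_subst_def)
    moreover have "body_size D2 = body_size C2" using \<sigma>2(2) by auto
    ultimately show ?thesis using D2 C2(5)
      by (auto simp: bounded_def numeral_eq_enat set_atoms_literals)
  qed
  moreover have "body_size C - 1 < body_size C" using C1(6) by simp
  ultimately show ?thesis by blast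
qed

section \<open>Irreducible clauses\<close>

text \<open>It suffices to follow one atom \<open>H\<close>: if it is not inside \<open>S\<close>,
  it is inside the complement, which no atom straddles either.\<close>

lemma connI:
  assumes "H \<in> K" and "\<And>S. \<forall>A\<in>K. av A \<subseteq> S \<or> av A \<inter> S = {} \<Longrightarrow> av H \<subseteq> S \<Longrightarrow> \<forall>A\<in>K. av A \<subseteq> S"
  shows "conn K"
  unfolding conn_def
proof (intro allI impI)
  fix S assume *: "\<forall>A\<in>K. av A \<subseteq> S \<or> av A \<inter> S = {}"
  show "(\<forall>A\<in>K. av A \<subseteq> S) \<or> (\<forall>A\<in>K. av A \<inter> S = {})"
  proof (cases "av H \<subseteq> S")
    case True
    then show ?thesis using assms(2)[OF *] by blast
  next
    case False
    then have "av H \<subseteq> - S" using * assms(1) by blast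
    moreover have "\<forall>A\<in>K. av A \<subseteq> - S \<or> av A \<inter> - S = {}" using * by blast
    ultimately have "\<forall>A\<in>K. av A \<subseteq> - S" using assms(2) by blast
    then show ?thesis by blast
  qed
qed

lemma connD:
  assumes "conn K" "\<forall>A\<in>K. av A \<subseteq> S \<or> av A \<inter> S = {}" "A \<in> K" "av A \<inter> S \<noteq> {}" "B \<in> K"
  shows "av B \<subseteq> S"
  using assms unfolding conn_def by blast

text \<open>An atom with a single variable straddles no set, so it puts no constraint on
  \<open>S\<close>.\<close>

lemma conn_delete_unary: "conn (insert H K) \<Longrightarrow> av H = {v} \<Longrightarrow> conn K"
  unfolding conn_def
proof (intro allI impI)
  fix S assume *: "\<forall>S. (\<forall>A\<in>insert H K. av A \<subseteq> S \<or> av A \<inter> S = {}) \<longrightarrow>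
     (\<forall>A\<in>insert H K. av A \<subseteq> S) \<or> (\<forall>A\<in>insert H K. av A \<inter> S = {})" "av H = {v}"
    "\<forall>A\<in>K. av A \<subseteq> S \<or> av A \<inter> S = {}"
  have "\<forall>A\<in>insert H K. av A \<subseteq> S \<or> av A \<inter> S = {}" using *(2,3) by auto
  with *(1) show "(\<forall>A\<in>K. av A \<subseteq> S) \<or> (\<forall>A\<in>K. av A \<inter> S = {})" by blast
qed

section \<open>Closing up a part of a clause by a new edge\<close>

text \<open>A variable of \<open>Y\<close> whose second occurrence is outside \<open>Y\<close> is
  shared with the rest and hence occurs in \<open>H\<close>.\<close>

lemma two_occ_split:
  assumes "two_occ K" "Y \<subseteq> K" "H \<notin> K" "av H = (\<Union>A\<in>Y. av A) \<inter> (\<Union>A\<in>K - Y. av A)"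
  shows "two_occ (insert H Y)"
  unfolding two_occ_def
proof (intro ballI)
  fix A x assume A: "A \<in> insert H Y" "x \<in> av A"
  show "\<exists>B\<in>insert H Y. B \<noteq> A \<and> x \<in> av B"
  proof (cases "A = H")
    case True
    then obtain B where "B \<in> Y" "x \<in> av B" using A assms(4) by auto
    then show ?thesis using True assms(2,3) by (intro bexI[of _ B]) auto
  next
    case False
    then have AY: "A \<in> Y" using A by simp
    then obtain B where B: "B \<in> K" "B \<noteq> A" "x \<in> av B"
      using A assms(1,2) unfolding two_occ_def by blast
    show ?thesis
    proof (cases "B \<in> Y")
      case True then show ?thesis using B by blast
    next
      case nB: False
      then have "x \<in> av H" using B AY A(2) assms(4) by auto
      then show ?thesis using False by auto
    qed
  qed
qed

text \<open>Adding all variables of the rest to \<open>S\<close> gives a set that no atom of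
  \<open>K\<close> straddles, because whatever \<open>Y\<close> shares with the rest lies in
  \<open>H\<close> and so in \<open>S\<close>.\<close>

lemma conn_split:
  assumes "conn K" "Y \<subseteq> K" "\<And>A. A \<in> K \<Longrightarrow> av A \<noteq> {}"
    and H: "av H = (\<Union>A\<in>Y. av A) \<inter> (\<Union>A\<in>K - Y. av A)" "av H \<noteq> {}"
  shows "conn (insert H Y)"
proof (rule connI[of H])
  fix S assume S: "\<forall>A\<in>insert H Y. av A \<subseteq> S \<or> av A \<inter> S = {}" and HS: "av H \<subseteq> S"
  let ?S = "S \<union> (\<Union>A\<in>K - Y. av A)"
  have out: "av A \<inter> ?S = {}" if "A \<in> Y" "av A \<inter> S = {}" for A
  proof -
    have "av A \<inter> (\<Union>A\<in>K - Y. av A) \<subseteq> S" using H(1) HS that(1) by blast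
    then show ?thesis using that(2) by blast
  qed
  have nc: "\<forall>A\<in>K. av A \<subseteq> ?S \<or> av A \<inter> ?S = {}"
  proof
    fix A assume "A \<in> K"
    show "av A \<subseteq> ?S \<or> av A \<inter> ?S = {}"
    proof (cases "A \<in> Y")
      case True then show ?thesis using S out[of A] by blast
    next
      case False then show ?thesis using \<open>A \<in> K\<close> by blast
    qed
  qed
  obtain A0 v where "A0 \<in> Y" "v \<in> av A0" "v \<in> av H" using H by auto
  then have all: "av B \<subseteq> ?S" if "B \<in> K" for B
    using connD[OF assms(1) nc, of A0 B] that HS assms(2) by blast
  show "\<forall>A\<in>insert H Y. av A \<subseteq> S"
  proof
    fix A assume A: "A \<in> insert H Y"
    show "av A \<subseteq> S"
    proof (rule ccontr)
      assume "\<not> av A \<subseteq> S"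
      then have AY: "A \<in> Y" "av A \<inter> S = {}" using A S HS by auto
      then have "A \<in> K" using assms(2) by auto
      show False using out[OF AY] all[OF \<open>A \<in> K\<close>] assms(3)[OF \<open>A \<in> K\<close>] by blast
    qed
  qed
qed simp

lemma distinct_atomsI:
  assumes "finite B" "set_option h \<inter> B = {}"
  shows "distinct_atoms (Clause h (mset_set B))"
  using assms by (auto simp: distinct_atoms_def atoms_def count_mset_set' split: option.split)

text \<open>The negation of the claim for a single clause; the structure of such a \<open>C\<close>
  is worked out until it becomes contradictory.\<close>

locale irreducible_clause =
  fixes C :: clause
  assumes C: "C \<in> H2c" and arity_le: "\<And>A. A \<in># atoms C \<Longrightarrow> arity (pred A) \<le> 2"
    and size: "2 < body_size C"
    and irreducible: "\<not> (\<exists>b'<body_size C. \<exists>D1\<in>bounded H2c 2 (enat b'). \<exists>D2\<in>bounded H2c 2 (enat b').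
      std_resolution D1 D2 C)"
begin

abbreviation "K \<equiv> set_mset (atoms C)"
abbreviation "B \<equiv> set_mset (body C)"

lemma C_pre: "C \<in> pre_fragment" and C_distinct: "distinct_atoms C"
  using H2c_pre_fragment[OF C] H2c_distinct_atoms[OF C] by auto

lemma conn_K: "conn K" and two_K: "two_occ K"
  using C_pre pre_fragment_two_occ[OF C_pre C_distinct] by (auto simp: pre_fragment_def connected_conn)

lemma wf_K: "A \<in> K \<Longrightarrow> wf_atom A"
  using C_pre by (auto simp: pre_fragment_def wf_clause_iff)

lemma av_nonempty: "A \<in> K \<Longrightarrow> av A \<noteq> {}"
  using wf_K wf_atom_av by blast

lemma card_av_le: "A \<in> K \<Longrightarrow> card (av A) \<le> 2"
  using wf_K[of A] arity_le[of A] card_length[of "args A"] by (simp add: av_def wf_atom_def)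

lemma K_eq: "K = set_option (head C) \<union> B"
  by (rule set_atoms)

lemma head_notin: "set_option (head C) \<inter> B = {}"
proof -
  have "A \<notin> set_option (head C)" if "A \<in> B" for A
    using distinct_atoms_disjoint(1)[OF C_distinct] insert_DiffM[OF that] by metis
  then show ?thesis by auto
qed

lemma body_eq: "body C = mset_set B"
proof (rule multiset_eqI)
  fix A
  have "count (body C) A \<le> 1"
    using C_distinct unfolding distinct_atoms_def atoms_def by (metis count_union le_add2 le_trans)
  moreover have "count (body C) A \<noteq> 0 \<longleftrightarrow> A \<in> B" by (simp add: not_in_iff)
  ultimately have "count (body C) A = (if A \<in> B then 1 else 0)" by (metis le_antisym less_one linorder_not_le)
  then show "count (body C) A = count (mset_set B) A" by (simp add: count_mset_set')
qed

lemma body_size_eq: "body_size C = card B"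
  by (metis body_eq body_size_def size_mset_set)

section \<open>The two reductions: splitting off and path shortcut\<close>

text \<open>Otherwise the variables of \<open>Y\<close> would cut \<open>C\<close> into two
  parts.\<close>

lemma split_shared_nonempty:
  assumes Y: "Y \<subseteq> B" "Y \<noteq> {}" "Y \<noteq> B"
  shows "(\<Union>A\<in>Y. av A) \<inter> (\<Union>A\<in>K - Y. av A) \<noteq> {}"
proof
  assume V: "(\<Union>A\<in>Y. av A) \<inter> (\<Union>A\<in>K - Y. av A) = {}"
  let ?S = "\<Union>A\<in>Y. av A"
  have nc: "\<forall>A\<in>K. av A \<subseteq> ?S \<or> av A \<inter> ?S = {}" using V by blast
  obtain A0 where A0: "A0 \<in> Y" using Y by blast
  obtain A1 where A1: "A1 \<in> B" "A1 \<notin> Y" using Y by blast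
  have "A0 \<in> K" "A1 \<in> K" using A0 A1 Y K_eq by auto
  then have "av A1 \<subseteq> ?S" using connD[OF conn_K nc, of A0 A1] A0 av_nonempty[of A0] by blast
  then show False using V A1 \<open>A1 \<in> K\<close> av_nonempty[of A1] by blast
qed

text \<open>Reduction without overlap: one premise is \<open>C\<close> with \<open>Y\<close>
  replaced by a new atom \<open>H\<close> over \<open>V\<close>, the other has head \<open>H\<close>
  and body \<open>Y\<close>. Both bodies are smaller than that of \<open>C\<close>, as
  \<open>Y\<close> has at least two atoms and is not the whole body. The last assumption keeps the
  body of every generalisation of the second premise connected.\<close>

lemma no_split:
  assumes Y: "Y \<subseteq> B" "2 \<le> card Y" "Y \<noteq> B"
    and V: "V = (\<Union>A\<in>Y. av A) \<inter> (\<Union>A\<in>K - Y. av A)" "card V \<le> 2"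
    and Y': "card V \<le> 1 \<or> (\<exists>A A'. Y = {A, A'} \<and> av A \<inter> av A' \<noteq> {})"
  shows False
proof -
  have finY: "finite Y" using Y(1) finite_subset by blast
  have finV: "finite V" using finY by (simp add: V(1))
  have YK: "Y \<subseteq> K" using Y(1) K_eq by auto
  have "Y \<noteq> {}" using Y(2) by auto
  then have Vne: "V \<noteq> {}" using split_shared_nonempty[of Y] Y V(1) by simp
  then have V1: "1 \<le> card V" using finV by (simp add: Suc_leI card_gt_0_iff)
  obtain i where i: "PVar i (card V) \<notin> pvars C" using ex_fresh_pvar[OF finite_pvars] by blast
  define H where "H = Atom (PVar i (card V)) (sorted_list_of_set V)"
  have avH: "av H = V" using finV by (simp add: H_def av_def)
  have "pred H \<notin> pvars C" using i by (simp add: H_def)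
  then have HK: "H \<notin> K" unfolding pvars_eq by blast
  have wfH: "wf_atom H" using V1 finV by (simp add: wf_atom_def H_def)
  have arH: "arity (pred H) \<le> 2" using V(2) by (simp add: H_def)
  define C1 where "C1 = Clause (head C) (mset_set (insert H (B - Y)))"
  define C2 where "C2 = Clause (Some H) (mset_set Y)"
  have HB: "H \<notin> B - Y" "H \<notin> Y" using HK YK K_eq by auto
  have bC1: "body C1 = add_mset H (mset_set (B - Y))" using HB by (simp add: C1_def)
  have K1: "set_mset (atoms C1) = insert H (K - Y)"
    unfolding set_atoms[of C1] using head_notin Y(1) K_eq by (auto simp: C1_def)
  have K2: "set_mset (atoms C2) = insert H Y"
    using finY by (auto simp: set_atoms C2_def)
  have KY: "K - (K - Y) = Y" using YK by auto
  have d1: "distinct_atoms C1"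
    unfolding C1_def using head_notin HK K_eq by (intro distinct_atomsI) auto
  have d2: "distinct_atoms C2"
    unfolding C2_def using HB finY by (intro distinct_atomsI) auto
  have p1: "C1 \<in> pre_fragment"
  proof (rule pre_fragmentI)
    show "wf_clause C1" using wf_K wfH by (auto simp: wf_clause_iff K1)
    show "conn (set_mset (atoms C1))" unfolding K1
      by (rule conn_split[OF conn_K _ av_nonempty]) (use V Vne KY avH in auto)
    show "two_occ (set_mset (atoms C1))" unfolding K1
      by (rule two_occ_split[OF two_K]) (use V HK KY avH in auto)
  qed
  have p2: "C2 \<in> pre_fragment"
  proof (rule pre_fragmentI)
    show "wf_clause C2" using wf_K wfH YK by (auto simp: wf_clause_iff K2)
    show "conn (set_mset (atoms C2))" unfolding K2
      by (rule conn_split[OF conn_K YK av_nonempty]) (use V Vne avH in auto)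
    show "two_occ (set_mset (atoms C2))" unfolding K2
      by (rule two_occ_split[OF two_K YK HK]) (use V avH in auto)
  qed
  have cardB: "card (B - Y) = card B - card Y" using Y(1) finY by (simp add: card_Diff_subset)
  have "card Y < card B" using Y by (simp add: psubset_card_mono psubsetI)
  have conn2: "conn (set_mset (body D))"
    if D: "D \<in> pre_fragment" "is_subst \<sigma>" "subst_clause \<sigma> D = C2" for D \<sigma>
  proof -
    obtain H2 where H2: "head D = Some H2" "subst_atom \<sigma> H2 = H"
      using D(3) by (auto simp: subst_clause_def C2_def)
    have bD: "image_mset (subst_atom \<sigma>) (body D) = mset_set Y"
      using D(3) by (auto simp: subst_clause_def C2_def)
    have KD: "set_mset (atoms D) = insert H2 (set_mset (body D))" by (simp add: set_atoms H2)
    have lenH2: "length (args H2) = card V"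
    proof -
      have "length (args (subst_atom \<sigma> H2)) = card V" unfolding H2(2) by (simp add: H_def)
      then show ?thesis by simp
    qed
    have connD': "conn (insert H2 (set_mset (body D)))"
      using D(1) connected_conn[of D] by (simp add: pre_fragment_def KD)
    show ?thesis
    \<comment> \<open>As \<open>V\<close> is nonempty, the first case is that of a unary head, whose
      removal preserves connectedness.\<close>
    proof (cases "card V \<le> 1")
      case True
      then have "card V = 1" using V1 by simp
      then obtain v where "args H2 = [v]" using lenH2 by (metis length_0_conv length_Suc_conv One_nat_def)
      then show ?thesis using conn_delete_unary[OF connD'] by (simp add: av_def)
    next
      case False
      then obtain A A' where A: "Y = {A, A'}" "av A \<inter> av A' \<noteq> {}" using Y' by blast
      then have "A \<noteq> A'" using Y(2) by auto
      then have "image_mset (subst_atom \<sigma>) (body D) = {#A, A'#}" using bD A by simp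
      then obtain X X' where X: "body D = {#X, X'#}" "subst_atom \<sigma> X = A" "subst_atom \<sigma> X' = A'"
        by (auto dest!: msed_map_invR)
      \<comment> \<open>If the two atoms were disjoint, all their variables would recur in the head,
        which has at most two. Each atom would then have one variable, \<open>\<sigma>\<close> would
        identify both as \<open>A\<close> and \<open>A'\<close> meet, and \<open>H\<close> would
        have only one variable.\<close>
      have "av X \<inter> av X' \<noteq> {}"
      proof
        assume dj: "av X \<inter> av X' = {}"
        have "distinct_atoms D" using d2 D(3) distinct_atoms_subst(1) by blast
        then have "two_occ {H2, X, X'}" using pre_fragment_two_occ[OF D(1)] KD X(1) by simp
        then have sub: "av X \<subseteq> av H2" "av X' \<subseteq> av H2" using dj unfolding two_occ_def by blast+
        have "av X \<noteq> {}" "av X' \<noteq> {}"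
          using D(1) X(1) wf_atom_av by (auto simp: pre_fragment_def wf_clause_iff KD)
        then obtain x x' where x: "x \<in> av X" "x' \<in> av X'" by blast
        have "card (av H2) \<le> 2" using lenH2 V(2) card_length[of "args H2"] by (simp add: av_def)
        moreover have "x \<noteq> x'" "{x, x'} \<subseteq> av H2" using x dj sub by auto
        ultimately have H2x: "av H2 = {x, x'}" by (metis card_2_iff card_seteq finite_av)
        then have "av X = {x}" "av X' = {x'}" using x sub dj by auto
        then have "on_tvar \<sigma> x = on_tvar \<sigma> x'" using A(2) X(2,3) by auto
        then have "av H = {on_tvar \<sigma> x}" using H2x by (auto simp: H2(2)[symmetric])
        then show False using avH False by simp
      qed
      then show ?thesis unfolding conn_def X(1) by auto
    qed
  qed
  have "\<exists>b'<body_size C. \<exists>D1\<in>bounded H2c 2 (enat b'). \<exists>D2\<in>bounded H2c 2 (enat b').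
    std_resolution D1 D2 C"
  proof (rule std_resolution_lift[OF C p1 d1 _ _ bC1 _ p2 d2 _ _ _ _ conn2])
    show "arity (pred A) \<le> 2" if "A \<in># atoms C1" for A
      using that arH arity_le by (auto simp: K1)
    show "arity (pred A) \<le> 2" if "A \<in># atoms C2" for A
      using that arH arity_le YK by (auto simp: K2)
    show "body_size C1 < body_size C"
      using \<open>card Y < card B\<close> Y(2) cardB by (simp add: body_size_def[of C1] bC1 body_size_eq)
    show "body_size C2 < body_size C"
      unfolding body_size_eq body_size_def[of C2] using \<open>card Y < card B\<close> by (simp add: C2_def)
    have "body C = mset_set (B - Y \<union> Y)" using Y(1) body_eq by (metis Diff_partition Un_commute)
    also have "\<dots> = mset_set (B - Y) + mset_set Y" using finY by (intro mset_set_Union) auto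
    finally show "body C = mset_set (B - Y) + body C2 \<or>
      (\<exists>M X0 Y0. mset_set (B - Y) = add_mset M X0 \<and> body C2 = add_mset M Y0 \<and>
         body C = add_mset M (X0 + Y0) \<and> av M \<inter> av H = {})" by (simp add: C2_def)
  qed (simp_all add: C1_def C2_def)
  then show False using irreducible by blast
qed

text \<open>Reduction with overlap: \<open>H\<close> replaces \<open>A\<close> and \<open>F\<close>
  in the first premise, \<open>M\<close> occurs in both premises, and its copies are merged, which
  is safe since \<open>M\<close> avoids \<open>a\<close> and \<open>d\<close>. Triangles with
  \<open>a = d\<close> are included. Four body atoms are required for the second premise, with
  three, to be smaller.\<close>

lemma no_path_shortcut:
  assumes AMF: "A \<in> B" "M \<in> B" "F \<in> B" "4 \<le> card B"
    and av: "av A = {a, b}" "av M = {b, c}" "av F = {c, d}"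
    and ne: "a \<noteq> b" "a \<noteq> c" "d \<noteq> b" "d \<noteq> c" "b \<noteq> c"
    and two: "\<And>H. H \<notin> K \<Longrightarrow> av H = {a, d} \<Longrightarrow> two_occ (insert H (K - {A, F}))"
    and conn: "\<And>H. av H = {a, d} \<Longrightarrow> conn (insert H (K - {A, F}))"
  shows False
proof -
  have dist: "A \<noteq> M" "A \<noteq> F" "M \<noteq> F" using av ne by auto
  obtain i where i: "PVar i 2 \<notin> pvars C" using ex_fresh_pvar[OF finite_pvars] by blast
  define H where "H = Atom (PVar i 2) [a, d]"
  have avH: "av H = {a, d}" by (simp add: H_def av_def)
  have "pred H \<notin> pvars C" using i by (simp add: H_def)
  then have HK: "H \<notin> K" unfolding pvars_eq by blast
  have wfH: "wf_atom H" by (simp add: wf_atom_def H_def)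
  have arH: "arity (pred H) \<le> 2" by (simp add: H_def)
  have YK: "{A, M, F} \<subseteq> K" using AMF K_eq by auto
  have HB: "H \<notin> B" using HK K_eq by auto
  define C1 where "C1 = Clause (head C) (mset_set (insert H (B - {A, F})))"
  define C2 where "C2 = Clause (Some H) (mset_set {A, M, F})"
  have bC1: "body C1 = add_mset H (mset_set (B - {A, F}))" using HB by (simp add: C1_def)
  have bC2: "body C2 = {#M, A, F#}" using dist by (simp add: C2_def)
  have K1: "set_mset (atoms C1) = insert H (K - {A, F})"
    unfolding set_atoms[of C1] using head_notin AMF K_eq by (auto simp: C1_def)
  have K2: "set_mset (atoms C2) = {H, A, M, F}"
    unfolding set_atoms by (auto simp: C2_def)
  have d1: "distinct_atoms C1"
    unfolding C1_def using head_notin HK K_eq by (intro distinct_atomsI) auto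
  have d2: "distinct_atoms C2"
    unfolding C2_def using HB AMF by (intro distinct_atomsI) auto
  have p1: "C1 \<in> pre_fragment"
  proof (rule pre_fragmentI)
    show "wf_clause C1" using wf_K wfH by (auto simp: wf_clause_iff K1)
    show "conn (set_mset (atoms C1))" unfolding K1 by (rule conn[OF avH])
    show "two_occ (set_mset (atoms C1))" unfolding K1 by (rule two[OF HK avH])
  qed
  have p2: "C2 \<in> pre_fragment"
  proof (rule pre_fragmentI)
    show "wf_clause C2" using wf_K wfH YK by (auto simp: wf_clause_iff K2)
    show "conn (set_mset (atoms C2))" unfolding K2
      by (rule connI[of H]) (auto simp: av avH)
    have "H \<noteq> A" "H \<noteq> F" using HB AMF by auto
    then show "two_occ (set_mset (atoms C2))" unfolding K2 two_occ_def
      using dist by (auto simp: av avH)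
  qed
  have conn2: "conn (set_mset (body D))"
    if D: "D \<in> pre_fragment" "is_subst \<sigma>" "subst_clause \<sigma> D = C2" for D \<sigma>
  proof -
    obtain H2 where H2: "head D = Some H2" "subst_atom \<sigma> H2 = H"
      using D(3) by (auto simp: subst_clause_def C2_def)
    have "image_mset (subst_atom \<sigma>) (body D) = {#M, A, F#}"
      using D(3) bC2 by (auto simp: subst_clause_def)
    then obtain M' A' F' where X: "body D = {#M', A', F'#}" "subst_atom \<sigma> M' = M"
      "subst_atom \<sigma> A' = A" "subst_atom \<sigma> F' = F"
      by (auto dest!: msed_map_invR)
    have KD: "set_mset (atoms D) = {H2, M', A', F'}" by (auto simp: set_atoms H2 X)
    have "distinct_atoms D" using d2 D(3) distinct_atoms_subst(1) by blast
    then have two2: "two_occ {H2, M', A', F'}" using pre_fragment_two_occ[OF D(1)] KD by simp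
    have img: "on_tvar \<sigma> ` av H2 = {a, d}" "on_tvar \<sigma> ` av M' = {b, c}"
      "on_tvar \<sigma> ` av A' = {a, b}" "on_tvar \<sigma> ` av F' = {c, d}"
      using av avH by (metis H2(2) X av_subst)+
    \<comment> \<open>A variable of \<open>A'\<close> that is mapped to \<open>b\<close> must recur,
      and among the other atoms only \<open>M'\<close> has a variable mapped to \<open>b\<close>.
      The same argument with \<open>c\<close> joins \<open>F'\<close> to \<open>M'\<close>.\<close>
    have "av A' \<inter> av M' \<noteq> {}"
    proof -
      obtain x where x: "x \<in> av A'" "on_tvar \<sigma> x = b" using img(3) by (metis imageE insertI1 insert_commute)
      then obtain Z where Z: "Z \<in> {H2, M', A', F'}" "Z \<noteq> A'" "x \<in> av Z"
        using two2 unfolding two_occ_def by blast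
      then have "b \<in> on_tvar \<sigma> ` av Z" using x(2) by blast
      then have "Z = M'" using Z(1,2) img ne by auto
      then show ?thesis using Z(3) x(1) by blast
    qed
    moreover have "av F' \<inter> av M' \<noteq> {}"
    proof -
      obtain x where x: "x \<in> av F'" "on_tvar \<sigma> x = c" using img(4) by (metis imageE insertI1)
      then obtain Z where Z: "Z \<in> {H2, M', A', F'}" "Z \<noteq> F'" "x \<in> av Z"
        using two2 unfolding two_occ_def by blast
      then have "c \<in> on_tvar \<sigma> ` av Z" using x(2) by blast
      then have "Z = M'" using Z(1,2) img ne by auto
      then show ?thesis using Z(3) x(1) by blast
    qed
    ultimately show ?thesis unfolding X(1) by (intro connI[of M']) auto
  qed
  \<comment> \<open>The decomposition for the second alternative of the lifting lemma:
    \<open>M\<close> belongs to both premises but occurs once in \<open>C\<close>.\<close>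
  have BAF: "body C = add_mset M (mset_set (B - {A, M, F}) + {#A, F#})"
    "mset_set (B - {A, F}) = add_mset M (mset_set (B - {A, M, F}))"
  proof -
    have 1: "B = (B - {A, M, F}) \<union> {A, M, F}" "B - {A, F} = insert M (B - {A, M, F})"
      using AMF dist by auto
    have "mset_set B = mset_set (B - {A, M, F}) + mset_set {A, M, F}"
      by (subst 1(1), rule mset_set_Union) auto
    then show "body C = add_mset M (mset_set (B - {A, M, F}) + {#A, F#})"
      using dist body_eq by (simp add: add_mset_commute)
    show "mset_set (B - {A, F}) = add_mset M (mset_set (B - {A, M, F}))"
      unfolding 1(2) by simp
  qed
  have "\<exists>b'<body_size C. \<exists>D1\<in>bounded H2c 2 (enat b'). \<exists>D2\<in>bounded H2c 2 (enat b').
    std_resolution D1 D2 C"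
  proof (rule std_resolution_lift[OF C p1 d1 _ _ bC1 _ p2 d2 _ _ _ _ conn2])
    show "arity (pred A) \<le> 2" if "A \<in># atoms C1" for A
      using that arH arity_le by (auto simp: K1)
    show "arity (pred A) \<le> 2" if "A \<in># atoms C2" for A
      using that arH arity_le YK by (auto simp: K2)
    have "card (B - {A, F}) = card B - 2" using AMF dist by (simp add: card_Diff_subset)
    then show "body_size C1 < body_size C"
      using AMF by (simp add: body_size_def[of C1] bC1 body_size_eq)
    show "body_size C2 < body_size C"
      using AMF by (simp add: body_size_def[of C2] bC2 body_size_eq)
    have "av M \<inter> av H = {}" using av avH ne by auto
    then show "body C = mset_set (B - {A, F}) + body C2 \<or>
      (\<exists>M X0 Y0. mset_set (B - {A, F}) = add_mset M X0 \<and> body C2 = add_mset M Y0 \<and>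
         body C = add_mset M (X0 + Y0) \<and> av M \<inter> av H = {})"
      using BAF bC2 by blast
  qed (simp_all add: C1_def C2_def)
  then show False using irreducible by blast
qed

section \<open>Structure of the body as a graph\<close>

text \<open>By \<open>no_split\<close> the pair shares at least three variables with the rest. Two
  atoms with at most two variables each and a common one have at most three together, so all these
  bounds are attained.\<close>

lemma adjacent_body_atoms:
  assumes A: "A \<in> B" "A' \<in> B" "A \<noteq> A'" "av A \<inter> av A' \<noteq> {}"
  shows "card (av A) = 2" "av A \<noteq> av A'" "av A \<union> av A' \<subseteq> (\<Union>X\<in>K - {A, A'}. av X)"
    "card (av A \<union> av A') = 3"
proof -
  define V where "V = (\<Union>X\<in>{A, A'}. av X) \<inter> (\<Union>X\<in>K - {A, A'}. av X)"
  have "3 \<le> card V"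
  proof (rule ccontr)
    assume "\<not> 3 \<le> card V"
    moreover have "{A, A'} \<noteq> B"
    proof
      assume "{A, A'} = B"
      then have "card B \<le> 2" by (metis card_2_iff A(3) order_refl)
      then show False using size body_size_eq by simp
    qed
    ultimately show False using no_split[OF _ _ _ V_def] A by auto
  qed
  moreover have VU: "V \<subseteq> av A \<union> av A'" by (auto simp: V_def)
  then have "card V \<le> card (av A \<union> av A')" by (intro card_mono) auto
  moreover have "card (av A) \<le> 2" "card (av A') \<le> 2" using A K_eq by (auto intro: card_av_le)
  moreover have "card (av A) + card (av A') = card (av A \<union> av A') + card (av A \<inter> av A')"
    by (rule card_Un_Int) auto
  moreover have "1 \<le> card (av A \<inter> av A')" using A(4) by (simp add: Suc_leI card_gt_0_iff)
  ultimately have *: "card (av A) = 2" "card (av A \<union> av A') = 3" "card V = card (av A \<union> av A')" by auto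
  then show "card (av A) = 2" "card (av A \<union> av A') = 3" by auto
  then show "av A \<noteq> av A'" by auto
  have "V = av A \<union> av A'" using *(3) VU by (intro card_subset_eq) auto
  then show "av A \<union> av A' \<subseteq> (\<Union>X\<in>K - {A, A'}. av X)" by (auto simp: V_def)
qed

text \<open>The variables exempt from the degree bound in \<open>degree_three\<close>; an empty set
  for a clause without head.\<close>

abbreviation "W \<equiv> \<Union>A\<in>set_option (head C). av A"

lemma card_W: "card W \<le> 2" and finite_W: "finite W"
proof -
  show "card W \<le> 2" using card_av_le K_eq by (cases "head C") auto
  show "finite W" by (cases "head C") auto
qed

text \<open>If \<open>S\<close> separates the body, the head straddles \<open>S\<close>, as
  \<open>C\<close> is connected, so each side contains at most one head variable. A side with two
  atoms could then be split off, and two sides with at most one atom each are too few.\<close>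

lemma conn_B: "conn B"
proof (rule ccontr)
  assume "\<not> conn B"
  then obtain S A1 A2 where S: "\<forall>A\<in>B. av A \<subseteq> S \<or> av A \<inter> S = {}"
    and A: "A1 \<in> B" "A2 \<in> B" "\<not> av A1 \<subseteq> S" "av A2 \<inter> S \<noteq> {}"
    unfolding conn_def by blast
  \<comment> \<open>Stated for arbitrary \<open>S\<close>, to be applied to the complement as
    well.\<close>
  have small: "card {A\<in>B. av A \<inter> S = {}} \<le> 1"
    if S: "\<forall>A\<in>B. av A \<subseteq> S \<or> av A \<inter> S = {}" and A: "A1 \<in> B" "A2 \<in> B" "\<not> av A1 \<subseteq> S" "av A2 \<inter> S \<noteq> {}"
    for S A1 A2
  proof (rule ccontr)
    let ?Y = "{A\<in>B. av A \<inter> S = {}}"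
    assume Y: "\<not> card ?Y \<le> 1"
    define V where "V = (\<Union>X\<in>?Y. av X) \<inter> (\<Union>X\<in>K - ?Y. av X)"
    have "V \<subseteq> W - S"
    proof
      fix x assume x: "x \<in> V"
      then have xS: "x \<notin> S" by (auto simp: V_def)
      from x obtain X where X: "X \<in> K" "X \<notin> ?Y" "x \<in> av X" by (auto simp: V_def)
      have "X \<notin> B" using X S xS by blast
      then show "x \<in> W - S" using X xS K_eq by auto
    qed
    moreover have "card (W - S) \<le> 1"
    proof (rule ccontr)
      assume "\<not> card (W - S) \<le> 1"
      then have "card (W - S) = card W"
        using card_W card_mono[of W "W - S"] finite_W by auto
      then have WS: "W \<inter> S = {}" using card_subset_eq[of W "W - S"] finite_W by blast
      have "\<forall>A\<in>K. av A \<subseteq> S \<or> av A \<inter> S = {}" using S WS K_eq by blast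
      then have "av A1 \<subseteq> S" using connD[OF conn_K, of S A2 A1] A K_eq by auto
      then show False using A by blast
    qed
    moreover have "card V \<le> card (W - S)" using calculation(1) finite_W by (intro card_mono) auto
    ultimately have "card V \<le> 1" by simp
    then show False using no_split[OF _ _ _ V_def] Y A by force
  qed
  have "card {A\<in>B. av A \<inter> S = {}} \<le> 1" by (rule small[OF S A])
  moreover have "card {A\<in>B. av A \<inter> - S = {}} \<le> 1"
  proof (rule small[OF _ A(2,1)])
    show "\<forall>A\<in>B. av A \<subseteq> - S \<or> av A \<inter> - S = {}" using S by blast
    show "\<not> av A2 \<subseteq> - S" "av A1 \<inter> - S \<noteq> {}" using A by blast+
  qed
  moreover have "B = {A\<in>B. av A \<inter> S = {}} \<union> {A\<in>B. av A \<inter> - S = {}}" using S by blast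
  then have "card B \<le> card {A\<in>B. av A \<inter> S = {}} + card {A\<in>B. av A \<inter> - S = {}}" by (metis (no_types, lifting) card_Un_le)
  ultimately show False using size body_size_eq by simp
qed

lemma ex_adjacent:
  assumes "A \<in> B"
  shows "\<exists>A'\<in>B. A' \<noteq> A \<and> av A \<inter> av A' \<noteq> {}"
proof (rule ccontr)
  assume *: "\<not> ?thesis"
  have "\<not> B \<subseteq> {A}" using size body_size_eq card_mono[of "{A}" B] by auto
  then obtain A' where A': "A' \<in> B" "A' \<noteq> A" by blast
  have "\<forall>X\<in>B. av X \<subseteq> av A \<or> av X \<inter> av A = {}"
    using * by (metis Int_commute subset_refl)
  then have "av A' \<subseteq> av A" using connD[OF conn_B, of "av A" A A'] assms A' av_nonempty[of A] K_eq by auto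
  then show False using * A' av_nonempty[of A'] K_eq by blast
qed

lemma card_av: "A \<in> B \<Longrightarrow> card (av A) = 2"
  using ex_adjacent[of A] adjacent_body_atoms(1)[of A] by blast

lemma simple: "A \<in> B \<Longrightarrow> A' \<in> B \<Longrightarrow> av A = av A' \<Longrightarrow> A = A'"
  using adjacent_body_atoms(2)[of A A'] av_nonempty[of A] K_eq by auto

lemma other_end:
  assumes "A \<in> B" "x \<in> av A"
  obtains y where "av A = {x, y}" "y \<noteq> x"
proof -
  obtain u v where "av A = {u, v}" "u \<noteq> v" using card_av[OF assms(1)] by (metis card_2_iff)
  then show thesis using assms(2) that by (metis doubleton_eq_iff insertE singletonD)
qed

text \<open>\<open>two_K\<close> gives a second body atom at \<open>x\<close>. Being adjacent, the
  two atoms share all their variables with the rest, so \<open>x\<close> occurs a third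
  time.\<close>

lemma degree_three:
  assumes "A \<in> B" "x \<in> av A" "x \<notin> W"
  obtains A' A'' where "A' \<in> B" "A'' \<in> B" "A \<noteq> A'" "A \<noteq> A''" "A' \<noteq> A''" "x \<in> av A'" "x \<in> av A''"
proof -
  have inB: "X \<in> B" if "X \<in> K" "x \<in> av X" for X using that assms(3) K_eq by auto
  have "A \<in> K" using assms(1) K_eq by auto
  then obtain A' where A': "A' \<in> K" "A' \<noteq> A" "x \<in> av A'"
    using two_K assms(2) unfolding two_occ_def by blast
  have "x \<in> (\<Union>X\<in>K - {A, A'}. av X)"
    using adjacent_body_atoms(3)[of A A'] assms A' inB by auto
  then obtain A'' where "A'' \<in> K" "A'' \<noteq> A" "A'' \<noteq> A'" "x \<in> av A''" by auto
  then show thesis using that[of A' A''] A' inB by auto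
qed

section \<open>Cuts, bridges and the final contradiction\<close>

text \<open>The shortcut along \<open>A\<close>, \<open>M\<close>, \<open>F\<close> must fail by
  irreducibility, and only connectedness can fail: \<open>A'\<close> and \<open>F'\<close> secure
  the second occurrences of \<open>b\<close> and \<open>c\<close>. A disconnection has the middle
  edge on one side and both ends of the path on the other.\<close>

lemma path_cut:
  assumes A: "A \<in> B" "M \<in> B" "F \<in> B" "A' \<in> B" "F' \<in> B"
    and av: "av A = {a, b}" "av M = {b, c}" "av F = {c, d}"
    and ne: "a \<noteq> b" "a \<noteq> c" "d \<noteq> b" "d \<noteq> c" "b \<noteq> c"
    and A': "A' \<noteq> A" "A' \<noteq> M" "b \<in> av A'" and F': "F' \<noteq> F" "F' \<noteq> M" "c \<in> av F'"
  shows "\<exists>S. b \<in> S \<and> c \<in> S \<and> a \<notin> S \<and> d \<notin> S \<and> (\<forall>X\<in>K - {A, F}. av X \<subseteq> S \<or> av X \<inter> S = {})"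
proof (rule ccontr)
  assume no: "\<not> ?thesis"
  have AK: "A \<in> K" "M \<in> K" "F \<in> K" "A' \<in> K" "F' \<in> K" using A K_eq by auto
  have dist: "A \<noteq> M" "A \<noteq> F" "M \<noteq> F" "F' \<noteq> A" "A' \<noteq> F" using av ne A' F' by auto
  have ad: "\<exists>X\<in>K - {A, F}. a \<in> av X" "\<exists>X\<in>K - {A, F}. d \<in> av X"
  proof -
    have "(\<exists>X\<in>K - {A, F}. a \<in> av X) \<and> (\<exists>X\<in>K - {A, F}. d \<in> av X)"
    \<comment> \<open>In a triangle \<open>A\<close> and \<open>F\<close> meet in \<open>a\<close>,
      and their adjacency yields a further atom there; otherwise the second atom at each end already
      differs from both.\<close>
    proof (cases "a = d")
      case True
      then have "av A \<inter> av F \<noteq> {}" using av by auto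
      then have "av A \<union> av F \<subseteq> (\<Union>X\<in>K - {A, F}. av X)"
        using adjacent_body_atoms(3)[of A F] A dist by auto
      then show ?thesis using True av by auto
    next
      case False
      obtain X where X: "X \<in> K" "X \<noteq> A" "a \<in> av X" using two_K AK(1) av(1) unfolding two_occ_def by blast
      obtain X' where X': "X' \<in> K" "X' \<noteq> F" "d \<in> av X'" using two_K AK(3) av(3) unfolding two_occ_def by blast
      have "X \<noteq> F" "X' \<noteq> A" using X X' av ne False by auto
      then show ?thesis using X X' by blast
    qed
    then show "\<exists>X\<in>K - {A, F}. a \<in> av X" "\<exists>X\<in>K - {A, F}. d \<in> av X" by auto
  qed
  show False
  proof (rule no_path_shortcut[OF A(1-3) _ av ne])
    have "card {A, M, F, A'} \<le> card B" using A by (intro card_mono) auto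
    then show "4 \<le> card B" using dist A' by simp
  next
    fix H assume H: "H \<notin> K" "av H = {a, d}"
    show "two_occ (insert H (K - {A, F}))" unfolding two_occ_def
    proof (intro ballI)
      fix X x assume X: "X \<in> insert H (K - {A, F})" "x \<in> av X"
      have ex2: "\<exists>Y\<in>insert H (K - {A, F}). Y \<noteq> X \<and> x \<in> av Y"
        if "Y1 \<in> insert H (K - {A, F})" "Y2 \<in> insert H (K - {A, F})" "Y1 \<noteq> Y2" "x \<in> av Y1" "x \<in> av Y2" for Y1 Y2
        using that by metis
      consider "x = a" | "x = d" | "x = b" | "x = c" | "x \<notin> {a, b, c, d}" by auto
      then show "\<exists>Y\<in>insert H (K - {A, F}). Y \<noteq> X \<and> x \<in> av Y"
      proof cases
        case 1
        then obtain Y where "Y \<in> K - {A, F}" "x \<in> av Y" using ad(1) by blast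
        then show ?thesis using ex2[of H Y] H 1 by auto
      next
        case 2
        then obtain Y where "Y \<in> K - {A, F}" "x \<in> av Y" using ad(2) by blast
        then show ?thesis using ex2[of H Y] H 2 by auto
      next
        case 3
        show ?thesis by (rule ex2[of M A']) (use 3 av A' AK dist in auto)
      next
        case 4
        show ?thesis by (rule ex2[of M F']) (use 4 av F' AK dist in auto)
      next
        case 5
        then have "X \<in> K" using X H by auto
        then obtain Y where Y: "Y \<in> K" "Y \<noteq> X" "x \<in> av Y" using X two_K unfolding two_occ_def by blast
        then have "Y \<noteq> A" "Y \<noteq> F" using 5 av by auto
        then show ?thesis using Y by blast
      qed
    qed
  next
    fix H assume H: "av H = {a, d}"
    show "conn (insert H (K - {A, F}))"
    proof (rule connI[of M])
      show "M \<in> insert H (K - {A, F})" using AK dist by auto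
    next
      fix S assume S: "\<forall>X\<in>insert H (K - {A, F}). av X \<subseteq> S \<or> av X \<inter> S = {}" and "av M \<subseteq> S"
      then have bc: "b \<in> S" "c \<in> S" using av by auto
      \<comment> \<open>Since \<open>H\<close> keeps \<open>a\<close> and \<open>d\<close> on the
        same side, both now lie in \<open>S\<close>. Then \<open>A\<close> and \<open>F\<close> are
        inside \<open>S\<close> as well, and no atom of \<open>C\<close> straddles
        \<open>S\<close>.\<close>
      have "\<not> (a \<notin> S \<and> d \<notin> S)" using no bc S by blast
      then have ad: "a \<in> S" "d \<in> S" using S H by auto
      have "\<forall>X\<in>K. av X \<subseteq> S \<or> av X \<inter> S = {}"
      proof
        fix X assume "X \<in> K"
        show "av X \<subseteq> S \<or> av X \<inter> S = {}"
          by (cases "X = A \<or> X = F") (use bc ad av S \<open>X \<in> K\<close> in auto)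
      qed
      then have "av X \<subseteq> S" if "X \<in> K" for X
        using connD[OF conn_K, of S M X] AK(2) that av bc by auto
      then show "\<forall>X\<in>insert H (K - {A, F}). av X \<subseteq> S" using H ad by auto
    qed
  qed
qed

text \<open>One side of the bridge \<open>F\<close> is free of the head. By
  \<open>degree_three\<close> it has two further atoms at its end of \<open>F\<close>, and this end
  is the only variable it shares with the rest, so it could be split off.\<close>

lemma no_body_bridge:
  assumes F: "F \<in> B" "av F = {c, d}" "c \<in> T" "d \<notin> T" "c \<notin> W"
    and T: "\<And>X. X \<in> K \<Longrightarrow> X \<noteq> F \<Longrightarrow> av X \<subseteq> T \<or> av X \<inter> T = {}"
  shows False
proof -
  have FK: "F \<in> K" using F K_eq by auto
  have card2: "2 \<le> card Y" if "X \<in> Y" "X' \<in> Y" "X \<noteq> X'" "Y \<subseteq> B" for Y X X'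
  proof -
    have "card {X, X'} \<le> card Y" using that finite_subset[of Y B] by (intro card_mono) auto
    then show ?thesis using that by simp
  qed
  show False
  proof (cases "W \<inter> T = {}")
    case True
    let ?Y = "{X\<in>K. X \<noteq> F \<and> av X \<subseteq> T}"
    have YB: "?Y \<subseteq> B"
    proof
      fix X assume X: "X \<in> ?Y"
      show "X \<in> B"
      proof (rule ccontr)
        assume "X \<notin> B"
        then have "av X \<subseteq> W" using X K_eq by auto
        then show False using X True av_nonempty[of X] by auto
      qed
    qed
    obtain X X' where X: "X \<in> B" "X' \<in> B" "F \<noteq> X" "F \<noteq> X'" "X \<noteq> X'" "c \<in> av X" "c \<in> av X'"
      by (rule degree_three[OF F(1), of c]) (use F in auto)
    have "X \<in> ?Y" "X' \<in> ?Y" using X T[of X] T[of X'] F(3) K_eq by auto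
    then have "2 \<le> card ?Y" by (intro card2[OF _ _ X(5) YB])
    moreover have "?Y \<noteq> B" using F(1) by auto
    moreover define V where "V = (\<Union>X\<in>?Y. av X) \<inter> (\<Union>X\<in>K - ?Y. av X)"
    have "V \<subseteq> {c}"
    proof
      fix x assume x: "x \<in> V"
      then have xT: "x \<in> T" by (auto simp: V_def)
      from x obtain Z where Z: "Z \<in> K" "Z \<notin> ?Y" "x \<in> av Z" by (auto simp: V_def)
      have "Z = F" using Z T[of Z] xT by auto
      then show "x \<in> {c}" using Z(3) F xT by auto
    qed
    then have "card V \<le> 1" using card_mono[of "{c}" V] by simp
    ultimately show False using no_split[OF YB _ _ V_def] by linarith
  next
    case False
    \<comment> \<open>The head is not \<open>F\<close>, so it lies entirely inside \<open>T\<close>,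
      and the side to split off is the one outside \<open>T\<close>.\<close>
    then obtain h where h: "head C = Some h" "av h \<inter> T \<noteq> {}" "W = av h" by (cases "head C") auto
    have "h \<noteq> F" using h(1) head_notin F(1) by auto
    then have WT: "W \<subseteq> T" using T[of h] h K_eq by auto
    let ?Y = "{X\<in>K. X \<noteq> F \<and> av X \<inter> T = {}}"
    have YB: "?Y \<subseteq> B" using h K_eq by auto
    have "d \<notin> W" using WT F by auto
    obtain X X' where X: "X \<in> B" "X' \<in> B" "F \<noteq> X" "F \<noteq> X'" "X \<noteq> X'" "d \<in> av X" "d \<in> av X'"
      by (rule degree_three[OF F(1), of d]) (use F \<open>d \<notin> W\<close> in auto)
    have "X \<in> ?Y" "X' \<in> ?Y" using X T[of X] T[of X'] F(4) K_eq by auto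
    then have "2 \<le> card ?Y" by (intro card2[OF _ _ X(5) YB])
    moreover have "?Y \<noteq> B" using F(1) by auto
    moreover define V where "V = (\<Union>X\<in>?Y. av X) \<inter> (\<Union>X\<in>K - ?Y. av X)"
    have "V \<subseteq> {d}"
    proof
      fix x assume x: "x \<in> V"
      then have xT: "x \<notin> T" by (auto simp: V_def)
      from x obtain Z where Z: "Z \<in> K" "Z \<notin> ?Y" "x \<in> av Z" by (auto simp: V_def)
      have "Z = F" using Z T[of Z] xT by auto
      then show "x \<in> {d}" using Z(3) F xT by auto
    qed
    then have "card V \<le> 1" using card_mono[of "{d}" V] by simp
    ultimately show False using no_split[OF YB _ _ V_def] by linarith
  qed
qed

text \<open>Two adjacent body atoms have three variables and the head has at most two, so some
  \<open>b\<close> is outside the head. It has three edges with distinct other ends, at least one of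
  which is again outside the head.\<close>

lemma ex_inner_edge:
  obtains A A' M b c where "A \<in> B" "A' \<in> B" "M \<in> B" "A \<noteq> A'" "A \<noteq> M" "A' \<noteq> M"
    "b \<in> av A" "b \<in> av A'" "av M = {b, c}" "b \<noteq> c" "b \<notin> W" "c \<notin> W"
proof -
  have "B \<noteq> {}" using size body_size_eq by auto
  then obtain A A' where A: "A \<in> B" "A' \<in> B" "A' \<noteq> A" "av A \<inter> av A' \<noteq> {}"
    using ex_adjacent by blast
  then have "card (av A \<union> av A') = 3" using adjacent_body_atoms(4)[of A A'] by auto
  then have "\<not> av A \<union> av A' \<subseteq> W" using card_W card_mono[OF finite_W, of "av A \<union> av A'"] by auto
  then obtain b X where b: "b \<notin> W" "X \<in> B" "b \<in> av X" using A by blast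
  obtain X' X'' where X: "X' \<in> B" "X'' \<in> B" "X \<noteq> X'" "X \<noteq> X''" "X' \<noteq> X''" "b \<in> av X'" "b \<in> av X''"
    by (rule degree_three[OF b(2,3,1)])
  obtain c where c: "av X = {b, c}" "c \<noteq> b" by (rule other_end[OF b(2,3)])
  obtain c' where c': "av X' = {b, c'}" "c' \<noteq> b" by (rule other_end[OF X(1,6)])
  obtain c'' where c'': "av X'' = {b, c''}" "c'' \<noteq> b" by (rule other_end[OF X(2,7)])
  have "c \<noteq> c'" "c \<noteq> c''" "c' \<noteq> c''" using simple X b c c' c'' by metis+
  then have "card {c, c', c''} = 3" by simp
  then have "\<not> {c, c', c''} \<subseteq> W" using card_W card_mono[OF finite_W, of "{c, c', c''}"] by auto
  then consider "c \<notin> W" | "c' \<notin> W" | "c'' \<notin> W" by blast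
  then show thesis
  proof cases
    case 1 then show thesis using that[of X' X'' X b c] X b c by auto
  next
    case 2 then show thesis using that[of X X'' X' b c'] X b c' by auto
  next
    case 3 then show thesis using that[of X X' X'' b c''] X b c'' by auto
  qed
qed

text \<open>If both shortcuts \<open>(A, F)\<close> and \<open>(A', F)\<close> disconnect the clause, the union of the two vertex
  sets cut off is separated from the rest by \<open>F\<close> alone.\<close>

lemma contradiction: False
proof -
  obtain A A' M b c where A: "A \<in> B" "A' \<in> B" "M \<in> B" "A \<noteq> A'" "A \<noteq> M" "A' \<noteq> M"
    "b \<in> av A" "b \<in> av A'" "av M = {b, c}" "b \<noteq> c" "b \<notin> W" "c \<notin> W"
    by (rule ex_inner_edge)
  obtain a where a: "av A = {b, a}" "a \<noteq> b" by (rule other_end[OF A(1,7)])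
  obtain a' where a': "av A' = {b, a'}" "a' \<noteq> b" by (rule other_end[OF A(2,8)])
  have cM: "c \<in> av M" using A by auto
  obtain F F' where F: "F \<in> B" "F' \<in> B" "M \<noteq> F" "M \<noteq> F'" "F \<noteq> F'" "c \<in> av F" "c \<in> av F'"
    by (rule degree_three[OF A(3) cM A(12)])
  obtain d where d: "av F = {c, d}" "d \<noteq> c" by (rule other_end[OF F(1,6)])
  \<comment> \<open>The graph is simple, so no other edge joins the ends of
    \<open>M\<close>.\<close>
  have ne: "a \<noteq> c" "a' \<noteq> c" "d \<noteq> b"
    using simple[of A M] simple[of A' M] simple[of F M] A F a a' d by (auto simp: insert_commute)
  have AF: "A \<noteq> F" "A' \<noteq> F" using a a' d ne A by auto
  obtain S where S: "b \<in> S" "c \<in> S" "a \<notin> S" "d \<notin> S" "\<forall>X\<in>K - {A, F}. av X \<subseteq> S \<or> av X \<inter> S = {}"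
    using path_cut[of A M F A' F' a b c d] A F a d ne by (auto simp: insert_commute)
  obtain S' where S': "b \<in> S'" "c \<in> S'" "a' \<notin> S'" "d \<notin> S'" "\<forall>X\<in>K - {A', F}. av X \<subseteq> S' \<or> av X \<inter> S' = {}"
    using path_cut[of A' M F A F' a' b c d] A F a' d ne by (auto simp: insert_commute)
  show False
  proof (rule no_body_bridge[of F c d "S \<union> S'"])
    fix X assume X: "X \<in> K" "X \<noteq> F"
    show "av X \<subseteq> S \<union> S' \<or> av X \<inter> (S \<union> S') = {}"
    proof (cases "X = A \<or> X = A'")
      case True
      then show ?thesis
      proof
        assume "X = A"
        \<comment> \<open>The second cut exempts \<open>A'\<close> and \<open>F\<close> only, so it
          does not cut \<open>A\<close>, which contains \<open>b\<close> and therefore lies inside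
          \<open>S'\<close>.\<close>
        then have "av X \<subseteq> S' \<or> av X \<inter> S' = {}" using S'(5) X A(4) by auto
        then show ?thesis using S'(1) a \<open>X = A\<close> by auto
      next
        assume "X = A'"
        then have "av X \<subseteq> S \<or> av X \<inter> S = {}" using S(5) X A(4) by auto
        then show ?thesis using S(1) a' \<open>X = A'\<close> by auto
      qed
    next
      case False
      then have "av X \<subseteq> S \<or> av X \<inter> S = {}" "av X \<subseteq> S' \<or> av X \<inter> S' = {}"
        using S(5) S'(5) X by auto
      then show ?thesis by blast
    qed
  qed (use F d S S' A in auto)
qed

end

theorem mainTheorem10: "reducible_R (bounded H2c 2 \<infinity>) 2"
  unfolding reducible_R_bounded_iff
proof (intro ballI impI)
  fix C assume C: "C \<in> bounded H2c 2 \<infinity>" "2 < body_size C"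
  show "\<exists>b'<body_size C. \<exists>C1\<in>bounded H2c 2 (enat b'). \<exists>C2\<in>bounded H2c 2 (enat b').
    std_resolution C1 C2 C"
  proof (rule ccontr)
    assume "\<not> ?thesis"
    with C interpret irreducible_clause C
      by unfold_locales (auto simp: bounded_def set_atoms_literals numeral_eq_enat)
    show False by (rule contradiction)
  qed
qed

end
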